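(* Let $\sigma<\frac12$ and $\rho=1-2\sigma$. For any even natural number $q$ such that $q\rho>1$ we have the Schatten norm convergence $$\left\|\rho N^{-\rho}\,\mathbf{T}_N(\psi_\sigma)^*\mathbf{T}_N(\psi_\sigma)-E(\sigma,1)\right\|_{\mathbf{S}_q}\to0\qquad\text{as } N\to\infty.$$
   Context: For real $\sigma$ and $N\in\mathbb{N}=\{1,2,\dots\}$, $\mathbf{T}_N(\psi_\sigma)$ is the $N\times N$ matrix (truncated multiplicative Toeplitz matrix with formal symbol $\psi_\sigma(s)=\zeta(\sigma+s)$) whose $(n,m)$ entry, $1\le n,m\le N$, equals $(n/m)^{-\sigma}$ if $m$ divides $n$ and $0$ otherwise. The $N\times N$ matrix $\rho N^{-\rho}\mathbf{T}_N(\psi_\sigma)^*\mathbf{T}_N(\psi_\sigma)$ is considered as an operator on $\ell^2(\mathbb{N})$ (extended by zero). $E(\sigma,1)$ is the operator on $\ell^2(\mathbb{N})$ with matrix $\left\{\frac{n^\sigma m^\sigma}{[n,m]}\right\}_{n,m=1}^\infty$, where $[n,m]$ is the least common multiple of $n$ and $m$. For $q>0$, $\mathbf{S}_q$ is the Schatten class of compact operators $A$ with $\|A\|_{\mathbf{S}_q}^q=\sum_{k\ge1} s_k(A)^q<\infty$, where $s_k(A)$ are the singular values of $A$. *)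

theory Defs
  imports "HOL-Analysis.Analysis"
begin

section \<open>The complex Hilbert space of square-summable sequences on the positive integers\<close>

text \<open>
  Sequences are indexed by the positive integers; the unused value at index 0 is fixed to 0.
\<close>

typedef ell2 = "{x :: nat \<Rightarrow> complex. x 0 = 0 \<and> summable (\<lambda>n. (cmod (x n))\<^sup>2)}"
  morphisms coord Abs_ell2
  by (rule exI[of _ "\<lambda>_. 0"]) simp

setup_lifting type_definition_ell2

lemma summable_coord: "summable (\<lambda>n. (cmod (coord x n))\<^sup>2)"
  using coord[of x] by simp

lemma coord_0 [simp]: "coord x 0 = 0"
  using coord[of x] by simp

lemma ell2_eqI: "(\<And>n. coord x n = coord y n) \<Longrightarrow> x = y"
  by (simp add: coord_inject[symmetric] fun_eq_iff)

lemma square_summable_add: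
  fixes x y :: "nat \<Rightarrow> complex"
  assumes "summable (\<lambda>n. (cmod (x n))\<^sup>2)" "summable (\<lambda>n. (cmod (y n))\<^sup>2)"
  shows "summable (\<lambda>n. (cmod (x n + y n))\<^sup>2)"
proof (rule summable_comparison_test')
  show "summable (\<lambda>n. 2 * (cmod (x n))\<^sup>2 + 2 * (cmod (y n))\<^sup>2)"
    using assms by (intro summable_add summable_mult)
  fix n :: nat
  have "(cmod (x n + y n))\<^sup>2 \<le> (cmod (x n) + cmod (y n))\<^sup>2"
    by (intro power_mono norm_triangle_ineq) simp
  also have "\<dots> \<le> 2 * (cmod (x n))\<^sup>2 + 2 * (cmod (y n))\<^sup>2"
    using sum_squares_bound[of "cmod (x n)" "cmod (y n)"] by (simp add: power2_sum)
  finally show "norm ((cmod (x n + y n))\<^sup>2) \<le> 2 * (cmod (x n))\<^sup>2 + 2 * (cmod (y n))\<^sup>2"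
    by simp
qed

lemma square_summable_scale:
  fixes x :: "nat \<Rightarrow> complex"
  assumes "summable (\<lambda>n. (cmod (x n))\<^sup>2)"
  shows "summable (\<lambda>n. (cmod (c * x n))\<^sup>2)"
  using summable_mult[OF assms, of "(cmod c)\<^sup>2"] by (simp add: norm_mult power_mult_distrib)

lemma summable_inner_coord: "summable (\<lambda>n. inner (coord x n) (coord y n))"
proof (rule summable_comparison_test')
  show "summable (\<lambda>n. (cmod (coord x n))\<^sup>2 + (cmod (coord y n))\<^sup>2)"
    by (intro summable_add summable_coord)
  fix n :: nat
  have "\<bar>inner (coord x n) (coord y n)\<bar> \<le> cmod (coord x n) * cmod (coord y n)"
    by (rule Cauchy_Schwarz_ineq2)
  also have "\<dots> \<le> 2 * cmod (coord x n) * cmod (coord y n)"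
    by simp
  also have "\<dots> \<le> (cmod (coord x n))\<^sup>2 + (cmod (coord y n))\<^sup>2"
    by (rule sum_squares_bound)
  finally show "norm (inner (coord x n) (coord y n)) \<le> (cmod (coord x n))\<^sup>2 + (cmod (coord y n))\<^sup>2"
    by simp
qed

lift_definition cscale :: "complex \<Rightarrow> ell2 \<Rightarrow> ell2" is "\<lambda>c x n. c * x n"
  using square_summable_scale by auto

text \<open>
  The instance below carries the real inner product, i.e. the real part of the Hermitian one;
  it induces the usual norm.
\<close>

instantiation ell2 :: real_inner
begin

lift_definition zero_ell2 :: ell2 is "\<lambda>_. 0"
  by simp

lift_definition plus_ell2 :: "ell2 \<Rightarrow> ell2 \<Rightarrow> ell2" is "\<lambda>x y n. x n + y n"
  by (auto intro: square_summable_add)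

lift_definition uminus_ell2 :: "ell2 \<Rightarrow> ell2" is "\<lambda>x n. - x n"
  by simp

lift_definition minus_ell2 :: "ell2 \<Rightarrow> ell2 \<Rightarrow> ell2" is "\<lambda>x y n. x n - y n"
  using square_summable_add[of _ "\<lambda>n. - _ n"] by auto

definition scaleR_ell2 :: "real \<Rightarrow> ell2 \<Rightarrow> ell2"
  where "scaleR_ell2 r x = cscale (complex_of_real r) x"

definition inner_ell2 :: "ell2 \<Rightarrow> ell2 \<Rightarrow> real"
  where "inner_ell2 x y = (\<Sum>n. inner (coord x n) (coord y n))"

definition norm_ell2 :: "ell2 \<Rightarrow> real"
  where "norm_ell2 x = sqrt (\<Sum>n. (cmod (coord x n))\<^sup>2)"

definition sgn_ell2 :: "ell2 \<Rightarrow> ell2"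
  where "sgn_ell2 x = scaleR (inverse (norm x)) x"

definition dist_ell2 :: "ell2 \<Rightarrow> ell2 \<Rightarrow> real"
  where "dist_ell2 x y = norm (x - y)"

definition uniformity_ell2 :: "(ell2 \<times> ell2) filter"
  where "uniformity_ell2 = (INF e\<in>{0<..}. principal {(x, y). dist x y < e})"

definition open_ell2 :: "ell2 set \<Rightarrow> bool"
  where "open_ell2 U \<longleftrightarrow> (\<forall>x\<in>U. eventually (\<lambda>(x', y). x' = x \<longrightarrow> y \<in> U) uniformity)"

instance
proof
  fix x y z :: ell2 and a b r :: real
  note c = zero_ell2.rep_eq plus_ell2.rep_eq uminus_ell2.rep_eq minus_ell2.rep_eq
    cscale.rep_eq scaleR_ell2_def
  show "x + y + z = x + (y + z)" "x + y = y + x" "0 + x = x" "- x + x = 0" "x - y = x + - y"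
    "a *\<^sub>R (x + y) = a *\<^sub>R x + a *\<^sub>R y" "(a + b) *\<^sub>R x = a *\<^sub>R x + b *\<^sub>R x"
    "a *\<^sub>R b *\<^sub>R x = (a * b) *\<^sub>R x" "1 *\<^sub>R x = x"
    by (auto intro!: ell2_eqI simp: c algebra_simps)
  show "dist x y = norm (x - y)" by (rule dist_ell2_def)
  show "sgn x = scaleR (inverse (norm x)) x" by (rule sgn_ell2_def)
  show "uniformity = (INF e\<in>{0<..}. principal {(x :: ell2, y). dist x y < e})"
    by (rule uniformity_ell2_def)
  show "open U \<longleftrightarrow> (\<forall>x\<in>U. eventually (\<lambda>(x', y). x' = x \<longrightarrow> y \<in> U) uniformity)" for U :: "ell2 set"
    by (rule open_ell2_def)
  show "inner x y = inner y x"
    by (simp add: inner_ell2_def inner_commute)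
  show "inner (x + y) z = inner x z + inner y z"
    by (simp add: inner_ell2_def c inner_add_left suminf_add summable_inner_coord)
  have "inner (complex_of_real r * u) v = r * inner u v" for u v :: complex
    by (simp add: inner_complex_def algebra_simps)
  then show "inner (r *\<^sub>R x) y = r * inner x y"
    by (simp add: inner_ell2_def c suminf_mult summable_inner_coord)
  have sq: "inner x x = (\<Sum>n. (cmod (coord x n))\<^sup>2)"
    by (simp add: inner_ell2_def dot_square_norm)
  then show "norm x = sqrt (inner x x)"
    by (simp add: norm_ell2_def)
  show "0 \<le> inner x x"
    unfolding sq by (intro suminf_nonneg summable_coord) simp
  show "inner x x = 0 \<longleftrightarrow> x = 0"
    unfolding sq by (subst suminf_eq_zero_iff[OF summable_coord])
      (auto intro!: ell2_eqI simp: c)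
qed

end

lift_definition unit_vec :: "nat \<Rightarrow> ell2" is "\<lambda>m n. if n = m \<and> n \<noteq> 0 then 1 else 0"
proof -
  fix m :: nat
  have "summable (\<lambda>n. (cmod (if n = m \<and> n \<noteq> 0 then 1 else 0))\<^sup>2)"
    by (rule summable_finite[of "{m}"]) auto
  then show "(if 0 = m \<and> 0 \<noteq> (0::nat) then 1 else (0::complex)) = 0 \<and>
      summable (\<lambda>n. (cmod (if n = m \<and> n \<noteq> 0 then 1 else 0))\<^sup>2)"
    by simp
qed

global_interpretation ell2: vector_space cscale
proof
  fix a b :: complex and x y :: ell2
  show "cscale a (x + y) = cscale a x + cscale a y" "cscale (a + b) x = cscale a x + cscale b x"
    "cscale a (cscale b x) = cscale (a * b) x" "cscale 1 x = x"
    by (auto intro!: ell2_eqI simp: cscale.rep_eq plus_ell2.rep_eq algebra_simps)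
qed


section \<open>Operators, singular values and Schatten classes\<close>

definition bounded_op :: "(ell2 \<Rightarrow> ell2) \<Rightarrow> bool"
  where "bounded_op A \<longleftrightarrow> bounded_linear A \<and> (\<forall>c x. A (cscale c x) = cscale c (A x))"

definition compact_op :: "(ell2 \<Rightarrow> ell2) \<Rightarrow> bool"
  where "compact_op A \<longleftrightarrow> bounded_op A \<and> compact (closure (A ` cball 0 1))"

definition has_matrix :: "(ell2 \<Rightarrow> ell2) \<Rightarrow> (nat \<Rightarrow> nat \<Rightarrow> complex) \<Rightarrow> bool"
  where "has_matrix A a \<longleftrightarrow>
    bounded_op A \<and> (\<forall>n\<ge>1. \<forall>m\<ge>1. coord (A (unit_vec m)) n = a n m)"

text \<open>
  The operator acting by matrix-vector multiplication. This is meaningful when the matrix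
  defines a bounded operator, i.e. when \<open>has_matrix (matrix_op a) a\<close> holds.
\<close>

definition matrix_op :: "(nat \<Rightarrow> nat \<Rightarrow> complex) \<Rightarrow> ell2 \<Rightarrow> ell2"
  where "matrix_op a x = Abs_ell2 (\<lambda>n. if n = 0 then 0 else (\<Sum>m. a n m * coord x m))"

text \<open>
  For \<open>k \<ge> 1\<close> and compact \<open>A\<close>, \<open>singular_value A k\<close> is the square root of the \<open>k\<close>-th largest
  eigenvalue of \<open>A\<^sup>* A\<close>, eigenvalues being repeated according to their (complex) multiplicity:
  there are at least \<open>k\<close> eigenvalues \<open>\<ge> t\<^sup>2\<close>, counted with multiplicity, iff there are \<open>k\<close>
  linearly independent eigenvectors with such eigenvalues. It is 0 if \<open>A\<^sup>* A\<close> has fewer than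
  \<open>k\<close> positive eigenvalues. For a complex-linear operator the adjoint with respect to the real
  inner product is the Hermitian adjoint.
\<close>

definition singular_value :: "(ell2 \<Rightarrow> ell2) \<Rightarrow> nat \<Rightarrow> real"
  where "singular_value A k = Sup (insert 0 {t. 0 < t \<and>
    (\<exists>V. finite V \<and> card V = k \<and> \<not> ell2.dependent V \<and>
       (\<forall>v\<in>V. \<exists>\<mu>\<ge>t\<^sup>2. adjoint A (A v) = \<mu> *\<^sub>R v))})"

definition schatten_class :: "real \<Rightarrow> (ell2 \<Rightarrow> ell2) set"
  where "schatten_class q =
    {A. compact_op A \<and> summable (\<lambda>k. singular_value A (Suc k) powr q)}"

definition schatten_norm :: "real \<Rightarrow> (ell2 \<Rightarrow> ell2) \<Rightarrow> real"
  where "schatten_norm q A = (\<Sum>k. singular_value A (Suc k) powr q) powr (1 / q)"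


section \<open>The truncated multiplicative Toeplitz matrix and the limit operator\<close>

definition toeplitz_matrix :: "real \<Rightarrow> nat \<Rightarrow> nat \<Rightarrow> nat \<Rightarrow> complex"
  where "toeplitz_matrix \<sigma> N n m =
    (if n \<in> {1..N} \<and> m \<in> {1..N} \<and> m dvd n
     then complex_of_real ((real n / real m) powr (- \<sigma>)) else 0)"

definition toeplitz_op :: "real \<Rightarrow> nat \<Rightarrow> ell2 \<Rightarrow> ell2"
  where "toeplitz_op \<sigma> N = matrix_op (toeplitz_matrix \<sigma> N)"

definition lcm_matrix :: "real \<Rightarrow> nat \<Rightarrow> nat \<Rightarrow> complex"
  where "lcm_matrix \<sigma> n m =
    complex_of_real (real n powr \<sigma> * real m powr \<sigma> / real (lcm n m))"

definition lcm_op :: "real \<Rightarrow> ell2 \<Rightarrow> ell2"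
  where "lcm_op \<sigma> = matrix_op (lcm_matrix \<sigma>)"

end

theory Submission
  imports Defs
begin

text \<open>
  Write \<open>L = lcm n m\<close> and \<open>E(\<theta>)\<close> for the matrix \<open>n\<^sup>\<theta> m\<^sup>\<theta> / L\<close>. Summing over the common
  multiples \<open>k = j L \<le> N\<close> of \<open>n\<close> and \<open>m\<close>, the entry of \<open>\<rho> N\<^bsup>-\<rho>\<^esup> T\<^sup>* T\<close> becomes
  \<open>n\<^sup>\<sigma> m\<^sup>\<sigma> / L\<close> times \<open>h(N/L)\<close>, where \<open>h(x) = \<rho> x\<^bsup>-\<rho>\<^esup> (\<Sum>j\<le>x. j\<^bsup>\<rho>-1\<^esup>)\<close>. Comparing the sum with an
  integral gives \<open>\<bar>h(x) - 1\<bar> \<le> C x\<^bsup>-\<eta>\<^esup>\<close> for every \<open>x > 0\<close> and small \<open>\<eta> > 0\<close>; for \<open>x < 1\<close> this holds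
  because \<open>h(x) = 0\<close> there. Since \<open>L \<le> n m\<close>, the difference matrix is dominated entry by entry by
  \<open>C N\<^bsup>-\<eta>\<^esup> E(\<sigma> + \<eta>)\<close> (\<open>toeplitz_gram_asymptotics\<close>). So the convergence comes with a rate, and what
  is left is to bound the Schatten norm of any matrix dominated by \<open>E(\<sigma> + \<eta>)\<close>.

  Singular values are not monotone under entrywise domination, but the norm bound of the Schur
  test is. Factor \<open>E(\<sigma> + \<eta>) = D\<^bsup>-\<kappa>\<^esup> E(1/2 - \<eta>) D\<^bsup>-\<kappa>\<^esup>\<close> with \<open>D = diag(1, 2, 3, \<dots>)\<close> and
  \<open>\<kappa> = \<rho>/2 - 2\<eta>\<close>. The middle factor passes the Schur test with weight \<open>n\<^bsup>-1/2\<^esup>\<close>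
  (\<open>lcm_kernel_row_sum\<close>): by \<open>gcd n m \<le> (\<Sum>d | d dvd n \<and> d dvd m. d)\<close> its weighted row sums are
  controlled by the number of divisors of \<open>n\<close>, which is \<open>O(n\<^sup>\<epsilon>)\<close> (\<open>divisor_count_le_powr\<close>). Hence
  every matrix \<open>a\<close> dominated by \<open>c E(\<sigma> + \<eta>)\<close>, restricted to rows and columns beyond \<open>M\<close>, has norm at
  most \<open>c K M\<^bsup>-2\<kappa>\<^esup>\<close>. This restriction differs from \<open>a\<close> by a matrix of rank at most \<open>2 M\<close>, so the
  \<open>k\<close>-th singular value of \<open>a\<close> is at most \<open>c K (k/2)\<^bsup>-2\<kappa>\<^esup>\<close> (\<open>singular_value_decaying_kernel\<close>). The sum
  of the \<open>q\<close>-th powers converges as soon as \<open>2 \<kappa> q > 1\<close>, which \<open>q \<rho> > 1\<close> permits for small \<open>\<eta>\<close>;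
  with \<open>c = C N\<^bsup>-\<eta>\<^esup>\<close> the norm tends to \<open>0\<close>.

  The definition of singular values through eigenvectors of \<open>A\<^sup>* A\<close> enters only in
  \<open>singular_value_bounds\<close>, the upper half of the Courant--Fischer principle. Membership in the Schatten class also asks for compactness, which follows because the
  rows beyond \<open>M\<close> have norm \<open>O(M\<^bsup>-\<kappa>\<^esup>)\<close> and \<open>\<ell>\<^sup>2\<close> is complete.
\<close>

section \<open>Divisor sums and lcm matrices\<close>

text \<open>
  The pairs \<open>(d, n)\<close> with \<open>d dvd n \<le> M\<close> are the pairs \<open>(d, d * j)\<close> with \<open>d * j \<le> M\<close>; enlarging this
  hyperbolic region to a square decouples the two sums.
\<close>
lemma sum_divisors_le_sum_pairs:
  fixes f :: "nat \<Rightarrow> nat \<Rightarrow> real"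
  assumes "\<And>d n. 0 \<le> f d n"
  shows "(\<Sum>n=1..M. \<Sum>d | d dvd n. f d n) \<le> (\<Sum>d=1..M. \<Sum>j=1..M. f d (d * j))"
proof -
  have "(\<Sum>n=1..M. \<Sum>d | d dvd n. f d n)
      = (\<Sum>(n, d)\<in>Sigma {1..M} (\<lambda>n. {d. d dvd n}). f d n)"
    by (rule sum.Sigma) auto
  also have "\<dots> \<le> (\<Sum>(d, j)\<in>{1..M} \<times> {1..M}. f d (d * j))"
  proof (rule sum_le_included[where i = "\<lambda>(d, j). (d * j, d)"])
    show "\<forall>x\<in>Sigma {1..M} (\<lambda>n. {d. d dvd n}). \<exists>y\<in>{1..M} \<times> {1..M}.
        (case y of (d, j) \<Rightarrow> (d * j, d)) = x \<and>
        (case x of (n, d) \<Rightarrow> f d n) \<le> (case y of (d, j) \<Rightarrow> f d (d * j))"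
    proof
      fix x assume "x \<in> Sigma {1..M} (\<lambda>n. {d. d dvd n})"
      then obtain d j where x: "x = (d * j, d)" and r: "1 \<le> d * j" "d * j \<le> M"
        by (auto elim!: dvdE)
      then have "d \<ge> 1" "j \<ge> 1" by auto
      moreover have "d \<le> M" "j \<le> M"
        using r \<open>d \<ge> 1\<close> \<open>j \<ge> 1\<close> by (metis le_trans mult.commute mult_le_mono2 mult.right_neutral)+
      ultimately show "\<exists>y\<in>{1..M} \<times> {1..M}. (case y of (d, j) \<Rightarrow> (d * j, d)) = x \<and>
          (case x of (n, d) \<Rightarrow> f d n) \<le> (case y of (d, j) \<Rightarrow> f d (d * j))"
        using x by (intro bexI[of _ "(d, j)"]) auto
    qed
  qed (use assms in \<open>auto intro!: finite_SigmaI\<close>)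
  also have "\<dots> = (\<Sum>d=1..M. \<Sum>j=1..M. f d (d * j))"
    by (simp add: sum.cartesian_product)
  finally show ?thesis .
qed

definition divisor_count :: "nat \<Rightarrow> nat"
  where "divisor_count n = card {d. d dvd n}"

lemma divisor_count_mult_le:
  assumes "m > 0" "n > 0"
  shows "divisor_count (m * n) \<le> divisor_count m * divisor_count n"
proof -
  have "{d. d dvd m * n} \<subseteq> (\<lambda>(a, b). a * b) ` ({d. d dvd m} \<times> {d. d dvd n})"
  proof
    fix d assume "d \<in> {d. d dvd m * n}"
    then obtain a b where "d = a * b" "a dvd m" "b dvd n"
      using division_decomp[of d m n] by auto
    then show "d \<in> (\<lambda>(a, b). a * b) ` ({d. d dvd m} \<times> {d. d dvd n})"
      by (intro image_eqI[of _ _ "(a, b)"]) auto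
  qed
  then have "divisor_count (m * n) \<le> card ({d. d dvd m} \<times> {d. d dvd n})"
    unfolding divisor_count_def using assms by (intro surj_card_le) auto
  then show ?thesis
    by (simp add: divisor_count_def card_cartesian_product)
qed

text \<open>
  One factor \<open>divisor_count n\<close> is turned into a sum over the divisors of \<open>n\<close>, and
  submultiplicativity of the remaining factors then bounds the \<open>(k+1)\<close>-st Dirichlet series by the
  square of the \<open>k\<close>-th.
\<close>
lemma divisor_count_moment_bounded:
  assumes "s > 1"
  shows "\<exists>C. \<forall>M. (\<Sum>n=1..M. real (divisor_count n) ^ k * real n powr (- s)) \<le> C"
proof (induction k)
  case 0
  have "summable (\<lambda>n. real n powr (- s))"
    using assms by (simp add: summable_real_powr_iff)
  then have "(\<Sum>n=1..M. real n powr (- s)) \<le> (\<Sum>n. real n powr (- s))" for M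
    by (intro sum_le_suminf) auto
  then show ?case by auto
next
  case (Suc k)
  define g where "g n = real (divisor_count n) ^ k * real n powr (- s)" for n
  obtain C where C: "(\<Sum>n=1..M. g n) \<le> C" for M
    using Suc unfolding g_def by blast
  have "(\<Sum>n=1..M. real (divisor_count n) ^ Suc k * real n powr (- s)) \<le> C\<^sup>2" for M
  proof -
    have "(\<Sum>n=1..M. real (divisor_count n) ^ Suc k * real n powr (- s))
        = (\<Sum>n=1..M. \<Sum>d | d dvd n. g n)"
      by (simp add: g_def mult.assoc flip: divisor_count_def)
    also have "\<dots> \<le> (\<Sum>d=1..M. \<Sum>j=1..M. g (d * j))"
      by (rule sum_divisors_le_sum_pairs) (simp add: g_def)
    also have "\<dots> \<le> (\<Sum>d=1..M. \<Sum>j=1..M. g d * g j)"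
    proof (intro sum_mono)
      fix d j assume "d \<in> {1..M}" "j \<in> {1..M}"
      then have "real (divisor_count (d * j)) \<le> real (divisor_count d) * real (divisor_count j)"
        using divisor_count_mult_le[of d j] by (simp flip: of_nat_mult)
      then have "real (divisor_count (d * j)) ^ k
          \<le> real (divisor_count d) ^ k * real (divisor_count j) ^ k"
        by (simp flip: power_mult_distrib add: power_mono)
      then have "real (divisor_count (d * j)) ^ k * (real d powr (- s) * real j powr (- s))
          \<le> real (divisor_count d) ^ k * real (divisor_count j) ^ k * (real d powr (- s) * real j powr (- s))"
        by (rule mult_right_mono) simp
      then show "g (d * j) \<le> g d * g j"
        by (simp add: g_def powr_mult mult_ac)
    qed
    also have "\<dots> = (\<Sum>n=1..M. g n)\<^sup>2"
      by (simp add: power2_eq_square sum_product)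
    also have "\<dots> \<le> C\<^sup>2"
      by (intro power_mono C sum_nonneg) (simp add: g_def)
    finally show ?thesis .
  qed
  then show ?case by blast
qed

text \<open>
  A single term of a high moment series is at most
  its sum, and the exponent \<open>2\<close> is divided by the order of the moment when the root is taken.
\<close>
lemma divisor_count_le_powr:
  assumes "\<epsilon> > 0"
  shows "\<exists>C>0. \<forall>n\<ge>1. real (divisor_count n) \<le> C * real n powr \<epsilon>"
proof -
  \<comment> \<open>the order of the moment, chosen so that \<open>n\<^sup>2 \<le> n\<^bsup>k \<epsilon>\<^esup>\<close>\<close>
  define k where "k = nat \<lceil>2 / \<epsilon>\<rceil>"
  have k: "2 \<le> real k * \<epsilon>" "k > 0"
  proof -
    have "2 / \<epsilon> \<le> real k" unfolding k_def by linarith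
    then show "2 \<le> real k * \<epsilon>" using assms by (simp add: field_simps)
    then show "k > 0" by (cases k) auto
  qed
  obtain C where C: "(\<Sum>n=1..M. real (divisor_count n) ^ k * real n powr (- 2)) \<le> C" for M
    using divisor_count_moment_bounded[of 2 k] by auto
  have "real (divisor_count n) \<le> max 1 C * real n powr \<epsilon>" if n: "n \<ge> 1" for n
  proof -
    define y where "y = real (divisor_count n) / real n powr \<epsilon>"
    have "y ^ k = real (divisor_count n) ^ k * real n powr (- (real k * \<epsilon>))"
      using n by (simp add: y_def power_divide powr_minus_divide powr_powr powr_power mult.commute)
    also have "\<dots> \<le> real (divisor_count n) ^ k * real n powr (- 2)"
      using n k by (intro mult_left_mono powr_mono) auto
    also have "\<dots> \<le> (\<Sum>n=1..n. real (divisor_count n) ^ k * real n powr (- 2))"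
      using n by (intro member_le_sum) auto
    also have "\<dots> \<le> C" by (rule C)
    finally have "y ^ k \<le> C" .
    moreover have "y \<le> y ^ k" if "y \<ge> 1"
      using that k by (intro self_le_power) auto
    ultimately have "y \<le> max 1 C" by linarith
    then show ?thesis using n by (simp add: y_def field_simps)
  qed
  then show ?thesis by (intro exI[of _ "max 1 C"]) auto
qed

text \<open>
  The same entries as \<open>lcm_matrix\<close>, kept real so that matrices with different exponents can be
  compared by inequalities.
\<close>
definition lcm_kernel :: "real \<Rightarrow> nat \<Rightarrow> nat \<Rightarrow> real"
  where "lcm_kernel \<theta> n m = real n powr \<theta> * real m powr \<theta> / real (lcm n m)"

lemma lcm_kernel_commute: "lcm_kernel \<theta> n m = lcm_kernel \<theta> m n"
  by (simp add: lcm_kernel_def lcm.commute mult.commute)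

lemma lcm_kernel_nonneg: "0 \<le> lcm_kernel \<theta> n m"
  by (simp add: lcm_kernel_def)

text \<open>
  Write \<open>1 / lcm n m = gcd n m / (n * m)\<close> and replace the gcd by the sum of all common divisors \<open>d\<close>.
  The sum over the multiples \<open>m\<close> of \<open>d\<close> converges thanks to \<open>\<delta> > 0\<close>, and each divisor \<open>d\<close> of \<open>n\<close>
  contributes a bounded amount. The factor \<open>n\<^bsup>-\<delta>\<^esup>\<close> left over absorbs the number of these divisors.
\<close>
lemma lcm_kernel_row_sum:
  assumes "\<delta> > 0"
  shows "\<exists>K>0. \<forall>n\<ge>1. \<forall>M.
    (\<Sum>m=1..M. lcm_kernel (1/2 - \<delta>) n m * real m powr (-1/2)) \<le> K * real n powr (-1/2)"
proof -
  obtain C where C: "C > 0" "\<And>n. n \<ge> 1 \<Longrightarrow> real (divisor_count n) \<le> C * real n powr \<delta>"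
    using divisor_count_le_powr[OF assms] by auto
  define Z where "Z = (\<Sum>j. real j powr (- 1 - \<delta>))"
  have sm: "summable (\<lambda>j. real j powr (- 1 - \<delta>))"
    using assms by (simp add: summable_real_powr_iff)
  have Z: "(\<Sum>j=1..M. real j powr (- 1 - \<delta>)) \<le> Z" for M
    unfolding Z_def by (rule sum_le_suminf[OF sm]) auto
  have "Z > 0"
    using Z[of 1] by simp
  have "(\<Sum>m=1..M. lcm_kernel (1/2 - \<delta>) n m * real m powr (-1/2)) \<le> (C * Z) * real n powr (-1/2)"
    if n: "n \<ge> 1" for n M
  proof -
    define f where "f d m = (if d dvd n then real d * real m powr (- 1 - \<delta>) else 0)" for d m :: nat
    have "lcm_kernel (1/2 - \<delta>) n m * real m powr (-1/2)
        \<le> real n powr (-1/2 - \<delta>) * (\<Sum>d | d dvd m. f d m)" if m: "m \<in> {1..M}" for m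
    proof -
      have pos: "real n > 0" "real m > 0" using n m by auto
      have "real (lcm n m) * real (gcd n m) = real n * real m"
        by (metis mult.commute of_nat_mult prod_gcd_lcm_nat)
      moreover have "real (gcd n m) > 0" "real (lcm n m) > 0"
        using n m by (auto intro: lcm_pos_nat)
      ultimately have inv: "1 / real (lcm n m) = real (gcd n m) / (real n * real m)"
        using pos by (simp add: field_simps)
      have pn: "real n powr (1/2 - \<delta>) / real n = real n powr (-1/2 - \<delta>)"
        using pos powr_diff[of "real n" "1/2 - \<delta>" 1] by simp
      have pm: "real m powr (1/2 - \<delta>) * real m powr (-1/2) / real m = real m powr (- 1 - \<delta>)"
        using pos powr_diff[of "real m" "- \<delta>" 1]
          powr_add[of "real m" "1/2 - \<delta>" "-1/2"]
        by (simp add: minus_diff_commute)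
      have "lcm_kernel (1/2 - \<delta>) n m * real m powr (-1/2)
          = real n powr (1/2 - \<delta>) * real m powr (1/2 - \<delta>) * real m powr (-1/2) * (1 / real (lcm n m))"
        by (simp add: lcm_kernel_def)
      also have "\<dots> = real (gcd n m) * (real n powr (1/2 - \<delta>) / real n)
          * (real m powr (1/2 - \<delta>) * real m powr (-1/2) / real m)"
        unfolding inv by simp
      also have "\<dots> = real (gcd n m) * real n powr (-1/2 - \<delta>) * real m powr (- 1 - \<delta>)"
        unfolding pn pm ..
      also have "\<dots> = real n powr (-1/2 - \<delta>) * f (gcd n m) m"
        by (simp add: f_def)
      also have "\<dots> \<le> real n powr (-1/2 - \<delta>) * (\<Sum>d | d dvd m. f d m)"
        using pos by (intro mult_left_mono member_le_sum) (auto simp: f_def)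
      finally show ?thesis .
    qed
    then have "(\<Sum>m=1..M. lcm_kernel (1/2 - \<delta>) n m * real m powr (-1/2))
        \<le> (\<Sum>m=1..M. real n powr (-1/2 - \<delta>) * (\<Sum>d | d dvd m. f d m))"
      by (rule sum_mono)
    also have "\<dots> = real n powr (-1/2 - \<delta>) * (\<Sum>m=1..M. \<Sum>d | d dvd m. f d m)"
      by (simp add: sum_distrib_left)
    also have "\<dots> \<le> real n powr (-1/2 - \<delta>) * (C * Z * real n powr \<delta>)"
    proof (rule mult_left_mono)
      have "(\<Sum>m=1..M. \<Sum>d | d dvd m. f d m) \<le> (\<Sum>d=1..M. \<Sum>j=1..M. f d (d * j))"
        by (rule sum_divisors_le_sum_pairs) (simp add: f_def)
      also have "\<dots> \<le> (\<Sum>d=1..M. if d dvd n then Z else 0)"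
      proof (rule sum_mono)
        fix d assume d: "d \<in> {1..M}"
        show "(\<Sum>j=1..M. f d (d * j)) \<le> (if d dvd n then Z else 0)"
        proof (cases "d dvd n")
          case True
          have "(\<Sum>j=1..M. f d (d * j))
              = real d powr 1 * real d powr (- 1 - \<delta>) * (\<Sum>j=1..M. real j powr (- 1 - \<delta>))"
            using True d by (simp add: f_def powr_mult sum_distrib_left mult.assoc)
          also have "\<dots> = real d powr (- \<delta>) * (\<Sum>j=1..M. real j powr (- 1 - \<delta>))"
            using d powr_add[of "real d" 1 "- 1 - \<delta>"] by simp
          also have "\<dots> \<le> 1 * Z"
          proof (intro mult_mono Z)
            show "real d powr (- \<delta>) \<le> 1"
              using d assms powr_mono[of "- \<delta>" 0 "real d"] by simp
          qed (auto intro: sum_nonneg)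
          finally show ?thesis using True by simp
        qed (simp add: f_def)
      qed
      also have "\<dots> = (\<Sum>d\<in>{1..M} \<inter> {d. d dvd n}. Z)"
        by (simp add: sum.inter_filter[symmetric] Int_def)
      also have "\<dots> \<le> (\<Sum>d\<in>{d. d dvd n}. Z)"
        using n \<open>Z > 0\<close> by (intro sum_mono2) auto
      also have "\<dots> = real (divisor_count n) * Z"
        by (simp add: divisor_count_def)
      also have "\<dots> \<le> C * real n powr \<delta> * Z"
        using C(2)[OF n] \<open>Z > 0\<close> by (intro mult_right_mono) auto
      finally show "(\<Sum>m=1..M. \<Sum>d | d dvd m. f d m) \<le> C * Z * real n powr \<delta>"
        by (simp add: mult_ac)
    qed simp
    also have "\<dots> = C * Z * (real n powr (-1/2 - \<delta>) * real n powr \<delta>)"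
      by simp
    also have "\<dots> = C * Z * real n powr (-1/2)"
      by (simp flip: powr_add)
    finally show ?thesis .
  qed
  then show ?thesis
    using C(1) \<open>Z > 0\<close> by (intro exI[of _ "C * Z"]) auto
qed

section \<open>Matrices as operators and the Schur test\<close>

text \<open>
  The hypothesis of the Schur test, for the rows and the columns of \<open>a\<close> at once so that it passes to
  adjoints. It is stated with partial sums, which keeps convergence questions out of it.
\<close>
definition schur_bound :: "(nat \<Rightarrow> nat \<Rightarrow> complex) \<Rightarrow> (nat \<Rightarrow> real) \<Rightarrow> real \<Rightarrow> bool"
  where "schur_bound a w K \<longleftrightarrow> 0 \<le> K \<and> (\<forall>n\<ge>1. 0 < w n) \<and>
    (\<forall>n\<ge>1. \<forall>M. (\<Sum>m=1..M. cmod (a n m) * w m) \<le> K * w n \<and>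
                (\<Sum>m=1..M. cmod (a m n) * w m) \<le> K * w n)"

lemma schur_bound_dominated:
  assumes b: "schur_bound b w K" and c: "0 \<le> c"
    and le: "\<And>n m. n \<ge> 1 \<Longrightarrow> m \<ge> 1 \<Longrightarrow> cmod (a n m) \<le> c * cmod (b n m)"
  shows "schur_bound a w (c * K)"
proof -
  have w: "w n > 0" if "n \<ge> 1" for n using b that by (simp add: schur_bound_def)
  have "(\<Sum>m=1..M. cmod (a n m) * w m) \<le> c * K * w n" (is ?A)
    "(\<Sum>m=1..M. cmod (a m n) * w m) \<le> c * K * w n" (is ?B) if n: "n \<ge> 1" for n M
  proof -
    have "(\<Sum>m=1..M. cmod (a n m) * w m) \<le> (\<Sum>m=1..M. c * cmod (b n m) * w m)"
      using le n w by (intro sum_mono mult_right_mono) (auto simp: less_imp_le)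
    also have "\<dots> = c * (\<Sum>m=1..M. cmod (b n m) * w m)"
      by (simp add: sum_distrib_left mult.assoc)
    also have "\<dots> \<le> c * (K * w n)"
      using b n c by (intro mult_left_mono) (auto simp: schur_bound_def)
    finally show ?A by (simp add: mult.assoc)
    have "(\<Sum>m=1..M. cmod (a m n) * w m) \<le> (\<Sum>m=1..M. c * cmod (b m n) * w m)"
      using le n w by (intro sum_mono mult_right_mono) (auto simp: less_imp_le)
    also have "\<dots> = c * (\<Sum>m=1..M. cmod (b m n) * w m)"
      by (simp add: sum_distrib_left mult.assoc)
    also have "\<dots> \<le> c * (K * w n)"
      using b n c by (intro mult_left_mono) (auto simp: schur_bound_def)
    finally show ?B by (simp add: mult.assoc)
  qed
  then show ?thesis using b c by (simp add: schur_bound_def)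
qed

lemma schur_bound_adjoint:
  "schur_bound a w K \<Longrightarrow> schur_bound (\<lambda>n m. cnj (a m n)) w K"
  by (simp add: schur_bound_def)

lemma schur_bound_finite_support:
  assumes "\<And>n m. n > N \<or> m > N \<Longrightarrow> a n m = 0"
  shows "\<exists>K. schur_bound a (\<lambda>_. 1) K"
proof -
  have supp: "i \<le> N \<and> j \<le> N" if "a i j \<noteq> 0" for i j
    using assms[of i j] that by linarith
  define K where "K = (\<Sum>(i, j)\<in>{1..N} \<times> {1..N}. cmod (a i j))"
  have "(\<Sum>m=1..M. cmod (a n m)) \<le> K" "(\<Sum>m=1..M. cmod (a m n)) \<le> K" if n: "n \<ge> 1" for n M
  proof -
    let ?s = "{m\<in>{1..M}. m \<le> N \<and> n \<le> N}"
    have "(\<Sum>m=1..M. cmod (a n m)) = (\<Sum>m\<in>?s. cmod (a n m))"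
      using supp by (intro sum.mono_neutral_right) auto
    also have "\<dots> \<le> K"
      unfolding K_def using n
      by (intro sum_le_included[where i = snd]) (auto intro!: bexI[of _ "(n, _)"])
    finally show "(\<Sum>m=1..M. cmod (a n m)) \<le> K" .
    have "(\<Sum>m=1..M. cmod (a m n)) = (\<Sum>m\<in>?s. cmod (a m n))"
      using supp by (intro sum.mono_neutral_right) auto
    also have "\<dots> \<le> K"
      unfolding K_def using n
      by (intro sum_le_included[where i = fst]) (auto intro!: bexI[of _ "(_, n)"])
    finally show "(\<Sum>m=1..M. cmod (a m n)) \<le> K" .
  qed
  moreover have "K \<ge> 0" unfolding K_def by (intro sum_nonneg) auto
  ultimately show ?thesis by (intro exI[of _ K]) (simp add: schur_bound_def)
qed

lemma norm_ell2_sq: "(norm x)\<^sup>2 = (\<Sum>n. (cmod (coord x n))\<^sup>2)"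
  by (simp add: norm_ell2_def suminf_nonneg summable_coord)

lemma cmod_coord_le_norm: "cmod (coord x n) \<le> norm x"
proof (rule power2_le_imp_le)
  show "(cmod (coord x n))\<^sup>2 \<le> (norm x)\<^sup>2"
    unfolding norm_ell2_sq using sum_le_suminf[OF summable_coord, of "{n}" x] by simp
qed simp

lemma sum_coord_le_norm: "finite F \<Longrightarrow> (\<Sum>n\<in>F. (cmod (coord x n))\<^sup>2) \<le> (norm x)\<^sup>2"
  unfolding norm_ell2_sq by (rule sum_le_suminf[OF summable_coord]) auto

lemma norm_ell2_leI:
  assumes "0 \<le> B" "\<And>I. (\<Sum>n=1..I. (cmod (coord x n))\<^sup>2) \<le> B\<^sup>2"
  shows "norm x \<le> B"
proof (rule power2_le_imp_le)
  show "(norm x)\<^sup>2 \<le> B\<^sup>2"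
    unfolding norm_ell2_sq
  proof (rule suminf_le_const[OF summable_coord])
    fix n
    have "(\<Sum>i<n. (cmod (coord x i))\<^sup>2) \<le> (\<Sum>i\<in>insert 0 {1..n}. (cmod (coord x i))\<^sup>2)"
      by (rule sum_mono2) auto
    also have "\<dots> = (\<Sum>i=1..n. (cmod (coord x i))\<^sup>2)" by simp
    finally show "(\<Sum>i<n. (cmod (coord x i))\<^sup>2) \<le> B\<^sup>2" using assms(2)[of n] by linarith
  qed
qed fact

text \<open>
  Cauchy--Schwarz with the splitting \<open>\<bar>a\<bar> \<bar>x\<bar> = sqrt (\<bar>a\<bar> w) * sqrt (\<bar>a\<bar> \<bar>x\<bar>\<^sup>2 / w)\<close> uses the row bound;
  exchanging the sums leaves weighted column sums.
\<close>
lemma schur_test_finite: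
  assumes "schur_bound a w K"
  shows "(\<Sum>n=1..I. (\<Sum>m=1..J. cmod (a n m) * cmod (coord x m))\<^sup>2) \<le> (K * norm x)\<^sup>2"
proof -
  have K: "K \<ge> 0" and w: "\<And>n. n \<ge> 1 \<Longrightarrow> w n > 0"
    and row: "\<And>n M. n \<ge> 1 \<Longrightarrow> (\<Sum>m=1..M. cmod (a n m) * w m) \<le> K * w n"
    and col: "\<And>n M. n \<ge> 1 \<Longrightarrow> (\<Sum>m=1..M. cmod (a m n) * w m) \<le> K * w n"
    using assms by (auto simp: schur_bound_def)
  define X where "X m = (cmod (coord x m))\<^sup>2" for m
  have "(\<Sum>m=1..J. cmod (a n m) * cmod (coord x m))\<^sup>2
      \<le> K * w n * (\<Sum>m=1..J. cmod (a n m) * X m / w m)" if n: "n \<ge> 1" for n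
  proof -
    have "(\<Sum>m=1..J. cmod (a n m) * cmod (coord x m))
        = (\<Sum>m=1..J. sqrt (cmod (a n m) * w m) * sqrt (cmod (a n m) * X m / w m))"
    proof (rule sum.cong[OF refl])
      fix m assume "m \<in> {1..J}"
      then have "w m > 0" using w by auto
      then have "(cmod (a n m) * w m) * (cmod (a n m) * X m / w m)
          = (cmod (a n m) * cmod (coord x m))\<^sup>2"
        by (simp add: X_def power2_eq_square)
      then show "cmod (a n m) * cmod (coord x m)
          = sqrt (cmod (a n m) * w m) * sqrt (cmod (a n m) * X m / w m)"
        by (simp add: real_sqrt_mult[symmetric] del: real_sqrt_mult)
    qed
    then have "(\<Sum>m=1..J. cmod (a n m) * cmod (coord x m))\<^sup>2 \<le>
        (\<Sum>m=1..J. (sqrt (cmod (a n m) * w m))\<^sup>2) * (\<Sum>m=1..J. (sqrt (cmod (a n m) * X m / w m))\<^sup>2)"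
      by (simp only: Cauchy_Schwarz_ineq_sum)
    also have "\<dots> = (\<Sum>m=1..J. cmod (a n m) * w m) * (\<Sum>m=1..J. cmod (a n m) * X m / w m)"
    proof -
      have "0 \<le> w m" if "m \<in> {1..J}" for m using w[of m] that by auto
      then show ?thesis by (simp add: X_def)
    qed
    also have "\<dots> \<le> K * w n * (\<Sum>m=1..J. cmod (a n m) * X m / w m)"
    proof (rule mult_right_mono[OF row[OF n]])
      have "0 \<le> w m" if "m \<in> {1..J}" for m using w[of m] that by auto
      then show "0 \<le> (\<Sum>m=1..J. cmod (a n m) * X m / w m)"
        by (intro sum_nonneg divide_nonneg_nonneg) (auto simp: X_def)
    qed
    finally show ?thesis .
  qed
  then have "(\<Sum>n=1..I. (\<Sum>m=1..J. cmod (a n m) * cmod (coord x m))\<^sup>2)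
      \<le> (\<Sum>n=1..I. K * w n * (\<Sum>m=1..J. cmod (a n m) * X m / w m))"
    by (intro sum_mono) auto
  also have "\<dots> = (\<Sum>n=1..I. \<Sum>m=1..J. K * (X m / w m) * (cmod (a n m) * w n))"
    by (simp add: sum_distrib_left mult_ac)
  also have "\<dots> = (\<Sum>m=1..J. K * (X m / w m) * (\<Sum>n=1..I. cmod (a n m) * w n))"
    by (subst sum.swap) (simp add: sum_distrib_left)
  also have "\<dots> \<le> (\<Sum>m=1..J. K * (X m / w m) * (K * w m))"
  proof (intro sum_mono mult_left_mono col)
    fix m assume "m \<in> {1..J}"
    then show "0 \<le> K * (X m / w m)" "1 \<le> m" using w[of m] K by (auto simp: X_def)
  qed
  also have "\<dots> = (\<Sum>m=1..J. K\<^sup>2 * X m)"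
  proof (rule sum.cong[OF refl])
    fix m assume "m \<in> {1..J}"
    then show "K * (X m / w m) * (K * w m) = K\<^sup>2 * X m" using w[of m] by (simp add: power2_eq_square)
  qed
  also have "\<dots> = K\<^sup>2 * (\<Sum>m=1..J. X m)" by (simp add: sum_distrib_left)
  also have "\<dots> \<le> K\<^sup>2 * (norm x)\<^sup>2"
    unfolding X_def by (intro mult_left_mono sum_coord_le_norm) auto
  finally show ?thesis by (simp add: power_mult_distrib)
qed

lemma sum_lessThan_Suc_eq_from_1:
  fixes f :: "nat \<Rightarrow> 'a::comm_monoid_add"
  shows "f 0 = 0 \<Longrightarrow> (\<Sum>m<Suc J. f m) = (\<Sum>m=1..J. f m)"
  by (simp add: lessThan_Suc_atMost atMost_atLeast0 sum.atLeast_Suc_atMost)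

lemma schur_bound_summable:
  assumes "schur_bound a w K" "n \<ge> 1"
  shows "summable (\<lambda>m. a n m * coord x m)"
proof (rule summable_norm_cancel, rule summableI_nonneg_bounded)
  fix J
  have "(\<Sum>m<J. cmod (a n m * coord x m)) \<le> (\<Sum>m<Suc J. cmod (a n m * coord x m))"
    by simp
  also have "\<dots> = (\<Sum>m=1..J. cmod (a n m) * cmod (coord x m))"
    by (simp add: sum_lessThan_Suc_eq_from_1 norm_mult del: sum.lessThan_Suc)
  also have "\<dots> \<le> K * norm x"
  proof (rule power2_le_imp_le)
    have "(\<Sum>m=1..J. cmod (a n m) * cmod (coord x m))\<^sup>2
        \<le> (\<Sum>n=1..n. (\<Sum>m=1..J. cmod (a n m) * cmod (coord x m))\<^sup>2)"
      using assms(2) by (intro member_le_sum[of n "{1..n}" "\<lambda>n. (\<Sum>m=1..J. cmod (a n m) * cmod (coord x m))\<^sup>2"]) auto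
    also have "\<dots> \<le> (K * norm x)\<^sup>2" by (rule schur_test_finite[OF assms(1)])
    finally show "(\<Sum>m=1..J. cmod (a n m) * cmod (coord x m))\<^sup>2 \<le> (K * norm x)\<^sup>2" .
    show "0 \<le> K * norm x" using assms(1) by (simp add: schur_bound_def)
  qed
  finally show "(\<Sum>m<J. cmod (a n m * coord x m)) \<le> K * norm x" .
qed simp

lemma schur_test:
  assumes "schur_bound a w K"
  shows "(\<Sum>n=1..I. (cmod (\<Sum>m. a n m * coord x m))\<^sup>2) \<le> (K * norm x)\<^sup>2"
proof (rule LIMSEQ_le_const2)
  show "(\<lambda>J. \<Sum>n=1..I. (cmod (\<Sum>m<Suc J. a n m * coord x m))\<^sup>2)
      \<longlonglongrightarrow> (\<Sum>n=1..I. (cmod (\<Sum>m. a n m * coord x m))\<^sup>2)"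
  proof (intro tendsto_sum tendsto_power tendsto_norm)
    fix n assume "n \<in> {1..I}"
    then have "summable (\<lambda>m. a n m * coord x m)"
      by (intro schur_bound_summable[OF assms]) auto
    then have "(\<lambda>J. \<Sum>m<J. a n m * coord x m) \<longlonglongrightarrow> (\<Sum>m. a n m * coord x m)"
      by (rule summable_LIMSEQ)
    then show "(\<lambda>J. \<Sum>m<Suc J. a n m * coord x m) \<longlonglongrightarrow> (\<Sum>m. a n m * coord x m)"
      by (rule LIMSEQ_Suc)
  qed
  have "(\<Sum>n=1..I. (cmod (\<Sum>m<Suc J. a n m * coord x m))\<^sup>2) \<le> (K * norm x)\<^sup>2" for J
  proof -
    have "(\<Sum>n=1..I. (cmod (\<Sum>m<Suc J. a n m * coord x m))\<^sup>2)
        \<le> (\<Sum>n=1..I. (\<Sum>m=1..J. cmod (a n m) * cmod (coord x m))\<^sup>2)"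
    proof (intro sum_mono power_mono)
      fix n
      have "(\<Sum>m<Suc J. a n m * coord x m) = (\<Sum>m=1..J. a n m * coord x m)"
        by (rule sum_lessThan_Suc_eq_from_1) simp
      then show "cmod (\<Sum>m<Suc J. a n m * coord x m) \<le> (\<Sum>m=1..J. cmod (a n m) * cmod (coord x m))"
        using norm_sum[of "\<lambda>m. a n m * coord x m" "{1..J}"] by (simp only: norm_mult)
    qed simp
    then show ?thesis using schur_test_finite[OF assms] order_trans by blast
  qed
  then show "\<exists>N. \<forall>J\<ge>N. (\<Sum>n=1..I. (cmod (\<Sum>m<Suc J. a n m * coord x m))\<^sup>2) \<le> (K * norm x)\<^sup>2"
    by blast
qed

lemma coord_matrix_op:
  assumes "schur_bound a w K"
  shows "coord (matrix_op a x) n = (if n = 0 then 0 else (\<Sum>m. a n m * coord x m))"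
proof -
  let ?y = "\<lambda>n. if n = 0 then 0 else (\<Sum>m. a n m * coord x m)"
  have "summable (\<lambda>n. (cmod (?y n))\<^sup>2)"
  proof (rule summableI_nonneg_bounded)
    fix I
    have "(\<Sum>n<I. (cmod (?y n))\<^sup>2) \<le> (\<Sum>n<Suc I. (cmod (?y n))\<^sup>2)" by simp
    also have "\<dots> = (\<Sum>n=1..I. (cmod (?y n))\<^sup>2)" by (rule sum_lessThan_Suc_eq_from_1) simp
    also have "\<dots> = (\<Sum>n=1..I. (cmod (\<Sum>m. a n m * coord x m))\<^sup>2)" by (intro sum.cong) auto
    also have "\<dots> \<le> (K * norm x)\<^sup>2" by (rule schur_test[OF assms])
    finally show "(\<Sum>n<I. (cmod (?y n))\<^sup>2) \<le> (K * norm x)\<^sup>2" .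
  qed simp
  then show ?thesis
    unfolding matrix_op_def by (subst Abs_ell2_inverse) auto
qed

lemma norm_matrix_op_le:
  assumes "schur_bound a w K"
  shows "norm (matrix_op a x) \<le> K * norm x"
proof (rule norm_ell2_leI)
  show "0 \<le> K * norm x" using assms by (simp add: schur_bound_def)
  show "(\<Sum>n=1..I. (cmod (coord (matrix_op a x) n))\<^sup>2) \<le> (K * norm x)\<^sup>2" for I
    using schur_test[OF assms, of x I] by (simp add: coord_matrix_op[OF assms])
qed

lemmas coord_simps = zero_ell2.rep_eq plus_ell2.rep_eq uminus_ell2.rep_eq minus_ell2.rep_eq
  cscale.rep_eq scaleR_ell2_def unit_vec.rep_eq

lemma bounded_op_matrix_op:
  assumes "schur_bound a w K"
  shows "bounded_op (matrix_op a)"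
proof -
  note c = coord_matrix_op[OF assms]
  have sm: "summable (\<lambda>m. a n m * coord x m)" if "n \<noteq> 0" for n x
    using schur_bound_summable[OF assms] that by auto
  have add: "matrix_op a (x + y) = matrix_op a x + matrix_op a y" for x y
    using sm by (intro ell2_eqI) (simp add: c coord_simps algebra_simps suminf_add)
  have scale: "matrix_op a (cscale u x) = cscale u (matrix_op a x)" for u x
  proof (rule ell2_eqI)
    fix n
    have "(\<Sum>m. a n m * (u * coord x m)) = (\<Sum>m. u * (a n m * coord x m))" by (simp add: mult_ac)
    also have "\<dots> = u * (\<Sum>m. a n m * coord x m)" if "n \<noteq> 0"
      using sm[OF that] by (rule suminf_mult)
    finally show "coord (matrix_op a (cscale u x)) n = coord (cscale u (matrix_op a x)) n"
      by (simp add: c coord_simps)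
  qed
  have "bounded_linear (matrix_op a)"
    using norm_matrix_op_le[OF assms]
    by (intro bounded_linear_intro[where K = K] add) (auto simp: scaleR_ell2_def scale mult.commute)
  then show ?thesis using scale by (simp add: bounded_op_def)
qed

lemma coord_matrix_op_unit_vec:
  assumes "schur_bound a w K" "n \<ge> 1" "m \<ge> 1"
  shows "coord (matrix_op a (unit_vec m)) n = a n m"
proof -
  have "(\<Sum>k. a n k * coord (unit_vec m) k) = (\<Sum>k\<in>{m}. a n k * coord (unit_vec m) k)"
    by (rule suminf_finite) (auto simp: coord_simps)
  then show ?thesis using assms by (simp add: coord_matrix_op[OF assms(1)] coord_simps)
qed

lemma has_matrix_matrix_op: "schur_bound a w K \<Longrightarrow> has_matrix (matrix_op a) a"
  by (simp add: has_matrix_def bounded_op_matrix_op coord_matrix_op_unit_vec)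

lemma coord_sum: "coord (\<Sum>i\<in>F. f i) n = (\<Sum>i\<in>F. coord (f i) n)"
  by (induction F rule: infinite_finite_induct) (auto simp: coord_simps)

text \<open>
  Used to verify the adjoint relation below on unit vectors only, which avoids exchanging two infinite
  sums.
\<close>
lemma finite_section_tendsto:
  "(\<lambda>J. \<Sum>m<J. cscale (coord x m) (unit_vec m)) \<longlonglongrightarrow> x"
proof -
  define D where "D J = x - (\<Sum>m<J. cscale (coord x m) (unit_vec m))" for J
  have D: "coord (D J) n = (if n < J then 0 else coord x n)" for J n
  proof -
    have "(\<Sum>m<J. coord (cscale (coord x m) (unit_vec m)) n)
        = (\<Sum>m<J. if m = n then coord x n else 0)"
      by (intro sum.cong) (auto simp: coord_simps)
    then show ?thesis by (simp add: D_def coord_simps coord_sum)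
  qed
  have n2: "(norm (D J))\<^sup>2 = (norm x)\<^sup>2 - (\<Sum>n<J. (cmod (coord x n))\<^sup>2)" for J
  proof -
    have "(norm (D J))\<^sup>2 = (\<Sum>n. (cmod (coord (D J) (n + J)))\<^sup>2) + (\<Sum>n<J. (cmod (coord (D J) n))\<^sup>2)"
      unfolding norm_ell2_sq by (rule suminf_split_initial_segment[OF summable_coord])
    also have "\<dots> = (\<Sum>n. (cmod (coord x (n + J)))\<^sup>2)" by (simp add: D)
    also have "\<dots> = (norm x)\<^sup>2 - (\<Sum>n<J. (cmod (coord x n))\<^sup>2)"
      unfolding norm_ell2_sq by (rule suminf_minus_initial_segment[OF summable_coord])
    finally show ?thesis .
  qed
  have "(\<lambda>J. (norm x)\<^sup>2 - (\<Sum>n<J. (cmod (coord x n))\<^sup>2)) \<longlonglongrightarrow> (norm x)\<^sup>2 - (norm x)\<^sup>2"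
    unfolding norm_ell2_sq by (intro tendsto_diff tendsto_const summable_LIMSEQ summable_coord)
  then have "(\<lambda>J. sqrt ((norm (D J))\<^sup>2)) \<longlonglongrightarrow> sqrt 0"
    unfolding n2 by (intro tendsto_real_sqrt) simp
  then have "(\<lambda>J. norm (D J)) \<longlonglongrightarrow> 0" by simp
  then have "D \<longlonglongrightarrow> 0" by (rule tendsto_norm_zero_cancel)
  then have "(\<lambda>J. x - D J) \<longlonglongrightarrow> x - 0" by (intro tendsto_diff tendsto_const)
  then show ?thesis by (simp add: D_def)
qed

lemma inner_matrix_op_adjoint:
  assumes "schur_bound a w K"
  shows "inner (matrix_op a x) y = inner x (matrix_op (\<lambda>n m. cnj (a m n)) y)"
proof -
  let ?A = "matrix_op a" and ?B = "matrix_op (\<lambda>n m. cnj (a m n))"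
  note b = schur_bound_adjoint[OF assms]
  have bl: "bounded_linear ?A" and sc: "?A (cscale u v) = cscale u (?A v)" for u v
    using bounded_op_matrix_op[OF assms] by (auto simp: bounded_op_def)
  have unit: "inner (?A (cscale u (unit_vec m))) y = inner (cscale u (unit_vec m)) (?B y)" for u m
  proof (cases "m = 0")
    case True
    then have z: "cscale u (unit_vec m) = 0" by (intro ell2_eqI) (auto simp: coord_simps)
    show ?thesis unfolding z using bl by (simp add: linear_simps)
  next
    case False
    have sm: "summable (\<lambda>n. cnj (a n m) * coord y n)"
      using schur_bound_summable[OF b, of m y] False by auto
    have "inner (?A (cscale u (unit_vec m))) y = (\<Sum>n. inner (u * a n m) (coord y n))"
      unfolding inner_ell2_def sc
    proof (rule arg_cong[where f = suminf], rule ext)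
      fix n show "inner (coord (cscale u (?A (unit_vec m))) n) (coord y n) = inner (u * a n m) (coord y n)"
        using False by (cases "n = 0") (auto simp: coord_matrix_op_unit_vec[OF assms] coord_simps)
    qed
    also have "\<dots> = (\<Sum>n. inner u (cnj (a n m) * coord y n))"
      by (simp add: inner_complex_def algebra_simps)
    also have "\<dots> = inner u (\<Sum>n. cnj (a n m) * coord y n)"
      by (rule bounded_linear.suminf[OF bounded_linear_inner_right sm, symmetric])
    also have "\<dots> = inner u (coord (?B y) m)"
      using False by (simp add: coord_matrix_op[OF b])
    also have "\<dots> = (\<Sum>n\<in>{m}. inner (coord (cscale u (unit_vec m)) n) (coord (?B y) n))"
      using False by (simp add: coord_simps)
    also have "\<dots> = inner (cscale u (unit_vec m)) (?B y)"
      unfolding inner_ell2_def by (rule suminf_finite[symmetric]) (auto simp: coord_simps)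
    finally show ?thesis .
  qed
  let ?S = "\<lambda>J. \<Sum>m<J. cscale (coord x m) (unit_vec m)"
  have "inner (?A (?S J)) y = inner (?S J) (?B y)" for J
    using bl by (simp add: linear_sum bounded_linear.linear inner_sum_left unit)
  moreover have "(\<lambda>J. inner (?A (?S J)) y) \<longlonglongrightarrow> inner (?A x) y"
    by (intro tendsto_inner bounded_linear.tendsto[OF bl] finite_section_tendsto tendsto_const)
  moreover have "(\<lambda>J. inner (?S J) (?B y)) \<longlonglongrightarrow> inner x (?B y)"
    by (intro tendsto_inner finite_section_tendsto tendsto_const)
  ultimately show ?thesis using LIMSEQ_unique by simp
qed

lemma adjoint_matrix_op:
  "schur_bound a w K \<Longrightarrow> adjoint (matrix_op a) = matrix_op (\<lambda>n m. cnj (a m n))"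
  by (intro adjoint_unique allI inner_matrix_op_adjoint)

section \<open>An upper bound for singular values\<close>

text \<open>
  A homogeneous system with more unknowns than equations has a nontrivial solution, by eliminating one
  unknown and one equation at a time.
\<close>
lemma nontrivial_combination_in_kernels:
  fixes L :: "nat \<Rightarrow> 'v \<Rightarrow> 'a::field"
  assumes "finite V" "m < card V"
  shows "\<exists>c. (\<exists>v\<in>V. c v \<noteq> 0) \<and> (\<forall>j<m. (\<Sum>v\<in>V. c v * L j v) = 0)"
  using assms
proof (induction m arbitrary: V L)
  case 0
  then obtain v where "v \<in> V" by fastforce
  then show ?case by (intro exI[of _ "\<lambda>_. 1"]) auto
next
  case (Suc m)
  show ?case
  proof (cases "\<forall>v\<in>V. L m v = 0")
    case True
    obtain c where "\<exists>v\<in>V. c v \<noteq> 0" "\<forall>j<m. (\<Sum>v\<in>V. c v * L j v) = 0"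
      using Suc.IH[of V L] Suc.prems by auto
    with True show ?thesis by (intro exI[of _ c]) (auto simp: less_Suc_eq)
  next
    case False
    then obtain v0 where v0: "v0 \<in> V" "L m v0 \<noteq> 0" by blast
    define W where "W = V - {v0}"
    \<comment> \<open>pivot: the last equation expresses the unknown of \<open>v0\<close> through the others\<close>
    define r where "r v = L m v / L m v0" for v
    have W: "finite W" "m < card W" "v0 \<notin> W" "V = insert v0 W"
      using Suc.prems v0(1) by (auto simp: W_def)
    obtain c where c: "\<exists>v\<in>W. c v \<noteq> 0"
        "\<And>j. j < m \<Longrightarrow> (\<Sum>v\<in>W. c v * (L j v - r v * L j v0)) = 0"
      using Suc.IH[OF W(1,2), of "\<lambda>j v. L j v - r v * L j v0"] by auto
    define c' where "c' = c(v0 := - (\<Sum>v\<in>W. c v * r v))"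
    have eq: "(\<Sum>v\<in>V. c' v * L j v) = (\<Sum>v\<in>W. c v * (L j v - r v * L j v0))" for j
    proof -
      have "(\<Sum>v\<in>W. c' v * L j v) = (\<Sum>v\<in>W. c v * L j v)"
        using W(3) by (intro sum.cong) (auto simp: c'_def)
      then show ?thesis
        using W by (simp add: c'_def algebra_simps sum_subtractf sum_distrib_left)
    qed
    have "(\<Sum>v\<in>V. c' v * L j v) = 0" if "j < Suc m" for j
    proof (cases "j = m")
      case True
      then show ?thesis unfolding eq using v0(2) by (simp add: r_def)
    next
      case False
      then show ?thesis unfolding eq using that by (intro c) auto
    qed
    moreover have "\<exists>v\<in>V. c' v \<noteq> 0"
      using c(1) W by (auto simp: c'_def)
    ultimately show ?thesis by blast
  qed
qed

text \<open>
  Eigenvectors for different eigenvalues of \<open>B A = A\<^sup>* A\<close> are orthogonal. Therefore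
  \<open>\<parallel>A x\<parallel>\<^sup>2 - t\<^sup>2 \<parallel>x\<parallel>\<^sup>2\<close> does not change when the weight \<open>\<mu> w - t\<^sup>2\<close> of a pair \<open>(v, w)\<close> is replaced by the
  geometric mean \<open>sqrt (\<mu> v - t\<^sup>2) * sqrt (\<mu> w - t\<^sup>2)\<close>, and then it is visibly a squared norm.
\<close>
lemma eigenvalue_lower_bound_on_span:
  assumes A: "bounded_op A" and B: "bounded_op B"
    and adj: "\<And>x y. inner (A x) y = inner x (B y)"
    and eig: "\<And>v. v \<in> V \<Longrightarrow> B (A v) = \<mu> v *\<^sub>R v" and ge: "\<And>v. v \<in> V \<Longrightarrow> t\<^sup>2 \<le> \<mu> v"
    and "0 \<le> t"
  shows "t * norm (\<Sum>v\<in>V. cscale (c v) v) \<le> norm (A (\<Sum>v\<in>V. cscale (c v) v))"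
proof -
  define y where "y v = cscale (c v) v" for v
  define x where "x = (\<Sum>v\<in>V. y v)"
  define s where "s v = sqrt (\<mu> v - t\<^sup>2)" for v
  have linA: "linear A" and linB: "linear B"
    using A B by (auto simp: bounded_op_def bounded_linear.linear)
  have eigy: "B (A (y v)) = \<mu> v *\<^sub>R y v" if "v \<in> V" for v
    using A B eig[OF that] by (simp add: bounded_op_def y_def scaleR_ell2_def mult.commute)
  have orth: "\<mu> v * inner (y v) (y w) = \<mu> w * inner (y v) (y w)" if "v \<in> V" "w \<in> V" for v w
  proof -
    have "\<mu> w * inner (y v) (y w) = inner (A (y v)) (A (y w))"
      using that by (simp add: adj eigy)
    also have "\<dots> = inner (A (y w)) (A (y v))" by (rule inner_commute)
    also have "\<dots> = \<mu> v * inner (y w) (y v)"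
      using that by (simp add: adj eigy)
    finally show ?thesis by (simp only: inner_commute)
  qed
  have "inner (A x) (A x) = inner x (\<Sum>v\<in>V. \<mu> v *\<^sub>R y v)"
    unfolding adj x_def by (simp add: linear_sum[OF linA] linear_sum[OF linB] eigy)
  then have "inner (A x) (A x) - t\<^sup>2 * inner x x = inner x (\<Sum>w\<in>V. (\<mu> w - t\<^sup>2) *\<^sub>R y w)"
    by (simp add: x_def algebra_simps sum_subtractf inner_diff_right flip: scaleR_sum_right)
  also have "\<dots> = (\<Sum>v\<in>V. inner (y v) (\<Sum>w\<in>V. (\<mu> w - t\<^sup>2) *\<^sub>R y w))"
    by (simp only: x_def inner_sum_left)
  also have "\<dots> = (\<Sum>v\<in>V. \<Sum>w\<in>V. (\<mu> w - t\<^sup>2) * inner (y v) (y w))"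
    by (simp only: inner_sum_right inner_scaleR_right)
  also have "\<dots> = (\<Sum>v\<in>V. \<Sum>w\<in>V. s v * s w * inner (y v) (y w))"
  proof (intro sum.cong refl)
    fix v w assume vw: "v \<in> V" "w \<in> V"
    show "(\<mu> w - t\<^sup>2) * inner (y v) (y w) = s v * s w * inner (y v) (y w)"
    proof (cases "inner (y v) (y w) = 0")
      case False
      then have "\<mu> v = \<mu> w" using orth[OF vw] by simp
      then show ?thesis using ge[OF vw(2)] by (simp add: s_def)
    qed simp
  qed
  also have "\<dots> = (\<Sum>v\<in>V. inner (s v *\<^sub>R y v) (\<Sum>w\<in>V. s w *\<^sub>R y w))"
    by (simp only: inner_sum_right inner_scaleR_left inner_scaleR_right mult_ac)
  also have "\<dots> = inner (\<Sum>v\<in>V. s v *\<^sub>R y v) (\<Sum>v\<in>V. s v *\<^sub>R y v)"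
    by (simp only: inner_sum_left)
  also have "\<dots> \<ge> 0" by simp
  finally have "(t * norm x)\<^sup>2 \<le> (norm (A x))\<^sup>2"
    by (simp add: power_mult_distrib dot_square_norm)
  then have "t * norm x \<le> norm (A x)"
    by (rule power2_le_imp_le) simp
  then show ?thesis by (simp add: x_def y_def)
qed

text \<open>
  If \<open>A\<close> is bounded by \<open>C\<close> on a subspace of codimension at most \<open>m < k\<close>, then the span of \<open>k\<close> independent
  eigenvectors meets this subspace nontrivially, and the preceding lower bound on the span forces
  \<open>t \<le> C\<close>.
\<close>
lemma singular_value_bounds:
  assumes A: "bounded_op A" and B: "bounded_op B"
    and adj: "\<And>x y. inner (A x) y = inner x (B y)"
    and L: "\<And>j x y. L j (x + y) = L j x + L j y" "\<And>j u x. L j (cscale u x) = u * L j x"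
    and bd: "\<And>x. (\<And>j. j < m \<Longrightarrow> L j x = 0) \<Longrightarrow> norm (A x) \<le> C * norm x"
    and "0 \<le> C" "m < k"
  shows "0 \<le> singular_value A k" "singular_value A k \<le> C"
proof -
  have adjA: "adjoint A = B" by (rule adjoint_unique) (use adj in blast)
  let ?T = "{t. 0 < t \<and> (\<exists>V. finite V \<and> card V = k \<and> \<not> ell2.dependent V \<and>
       (\<forall>v\<in>V. \<exists>\<mu>\<ge>t\<^sup>2. adjoint A (A v) = \<mu> *\<^sub>R v))}"
  have T: "t \<le> C" if tT: "t \<in> ?T" for t
  proof -
    obtain V where t: "0 < t" and V: "finite V" "card V = k" "\<not> ell2.dependent V"
      and "\<forall>v\<in>V. \<exists>\<mu>. t\<^sup>2 \<le> \<mu> \<and> B (A v) = \<mu> *\<^sub>R v"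
      using tT unfolding adjA by blast
    then obtain \<mu> where \<mu>: "\<And>v. v \<in> V \<Longrightarrow> t\<^sup>2 \<le> \<mu> v" "\<And>v. v \<in> V \<Longrightarrow> B (A v) = \<mu> v *\<^sub>R v"
      by metis
    obtain c where c: "\<exists>v\<in>V. c v \<noteq> 0" "\<And>j. j < m \<Longrightarrow> (\<Sum>v\<in>V. c v * L j v) = 0"
      using nontrivial_combination_in_kernels[of V m L] V \<open>m < k\<close> by blast
    define x where "x = (\<Sum>v\<in>V. cscale (c v) v)"
    have "x \<noteq> 0" using V(1,3) c(1) unfolding x_def by (auto simp: ell2.dependent_finite)
    have L0: "L j 0 = 0" for j using L(2)[of j 0 0] by simp
    have "L j x = (\<Sum>v\<in>V. c v * L j v)" for j
      unfolding x_def using V(1) by (induction V rule: finite_induct) (simp_all add: L L0)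
    then have "norm (A x) \<le> C * norm x" using c(2) by (intro bd) auto
    moreover have "t * norm x \<le> norm (A x)"
      unfolding x_def using t \<mu> by (intro eigenvalue_lower_bound_on_span[OF A B adj]) auto
    ultimately have "t * norm x \<le> C * norm x" by linarith
    then show ?thesis using \<open>x \<noteq> 0\<close> by simp
  qed
  have bdd: "bdd_above (insert 0 ?T)"
    using T \<open>0 \<le> C\<close> by (intro bdd_aboveI[of _ C]) blast
  show "0 \<le> singular_value A k"
    unfolding singular_value_def by (intro cSup_upper bdd) auto
  show "singular_value A k \<le> C"
    unfolding singular_value_def using T \<open>0 \<le> C\<close> by (intro cSup_least) blast+
qed

section \<open>A compactness criterion\<close>

text \<open>
  Coordinates of a Cauchy sequence converge, and bounds on finitely many coordinates survive the limit.
\<close>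
lemma complete_UNIV_ell2: "complete (UNIV :: ell2 set)"
  unfolding complete_def
proof (intro allI impI)
  fix X :: "nat \<Rightarrow> ell2" assume "(\<forall>n. X n \<in> UNIV) \<and> Cauchy X"
  then have X: "Cauchy X" by simp
  have "Cauchy (\<lambda>k. coord (X k) n)" for n
  proof (rule CauchyI)
    fix e :: real assume "e > 0"
    then obtain N where N: "\<And>j k. j \<ge> N \<Longrightarrow> k \<ge> N \<Longrightarrow> norm (X j - X k) < e"
      using CauchyD[OF X] by blast
    show "\<exists>N. \<forall>j\<ge>N. \<forall>k\<ge>N. cmod (coord (X j) n - coord (X k) n) < e"
    proof (intro exI[of _ N] allI impI)
      fix j k assume "j \<ge> N" "k \<ge> N"
      then show "cmod (coord (X j) n - coord (X k) n) < e"
        using cmod_coord_le_norm[of "X j - X k" n] N[of j k] by (simp add: coord_simps)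
    qed
  qed
  then have "convergent (\<lambda>k. coord (X k) n)" for n by (rule Cauchy_convergent)
  then obtain l where l: "\<And>n. (\<lambda>k. coord (X k) n) \<longlonglongrightarrow> l n"
    unfolding convergent_def by metis
  have near: "\<exists>N. \<forall>k\<ge>N. \<forall>F. finite F \<longrightarrow> (\<Sum>n\<in>F. (cmod (l n - coord (X k) n))\<^sup>2) \<le> e\<^sup>2"
    if "e > 0" for e :: real
  proof -
    obtain N where N: "\<And>j k. j \<ge> N \<Longrightarrow> k \<ge> N \<Longrightarrow> norm (X j - X k) < e"
      using CauchyD[OF X \<open>e > 0\<close>] by blast
    have "(\<Sum>n\<in>F. (cmod (l n - coord (X k) n))\<^sup>2) \<le> e\<^sup>2" if "k \<ge> N" "finite F" for k F
    proof (rule LIMSEQ_le_const2)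
      show "(\<lambda>j. \<Sum>n\<in>F. (cmod (coord (X j) n - coord (X k) n))\<^sup>2)
          \<longlonglongrightarrow> (\<Sum>n\<in>F. (cmod (l n - coord (X k) n))\<^sup>2)"
        by (intro tendsto_intros l)
      have "(\<Sum>n\<in>F. (cmod (coord (X j) n - coord (X k) n))\<^sup>2) \<le> e\<^sup>2" if "j \<ge> N" for j
      proof -
        have "(\<Sum>n\<in>F. (cmod (coord (X j) n - coord (X k) n))\<^sup>2) \<le> (norm (X j - X k))\<^sup>2"
          using sum_coord_le_norm[OF \<open>finite F\<close>, of "X j - X k"] by (simp add: coord_simps)
        also have "\<dots> \<le> e\<^sup>2" using N[OF that \<open>k \<ge> N\<close>] by (intro power_mono) auto
        finally show ?thesis .
      qed
      then show "\<exists>N. \<forall>j\<ge>N. (\<Sum>n\<in>F. (cmod (coord (X j) n - coord (X k) n))\<^sup>2) \<le> e\<^sup>2" by blast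
    qed
    then show ?thesis by blast
  qed
  have "l 0 = 0" using LIMSEQ_unique[OF l[of 0], of 0] by simp
  moreover have "summable (\<lambda>n. (cmod (l n))\<^sup>2)"
  proof -
    obtain N where N: "\<And>F. finite F \<Longrightarrow> (\<Sum>n\<in>F. (cmod (l n - coord (X N) n))\<^sup>2) \<le> 1\<^sup>2"
      using near[of 1] by auto
    have "summable (\<lambda>n. (cmod (l n - coord (X N) n))\<^sup>2)"
      using N by (intro summableI_nonneg_bounded[where x = 1]) auto
    from square_summable_add[OF this summable_coord[of "X N"]] show ?thesis by simp
  qed
  ultimately have y: "coord (Abs_ell2 l) = l"
    by (intro Abs_ell2_inverse) simp
  have "X \<longlonglongrightarrow> Abs_ell2 l"
  proof (rule LIMSEQ_I)
    fix e :: real assume "e > 0"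
    then obtain N where N: "\<And>k F. k \<ge> N \<Longrightarrow> finite F \<Longrightarrow> (\<Sum>n\<in>F. (cmod (l n - coord (X k) n))\<^sup>2) \<le> (e/2)\<^sup>2"
      using near[of "e/2"] by auto
    have "norm (X k - Abs_ell2 l) < e" if "k \<ge> N" for k
    proof -
      have "norm (Abs_ell2 l - X k) \<le> e / 2"
        using \<open>e > 0\<close> N[OF that] by (intro norm_ell2_leI) (auto simp: coord_simps y)
      then show ?thesis using \<open>e > 0\<close> by (simp add: norm_minus_commute)
    qed
    then show "\<exists>N. \<forall>k\<ge>N. norm (X k - Abs_ell2 l) < e" by blast
  qed
  then show "\<exists>l\<in>UNIV. X \<longlonglongrightarrow> l" by blast
qed

lemma compact_closure_of_compact_approximations:
  fixes S :: "'a::metric_space set"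
  assumes "complete (UNIV :: 'a set)"
    and approx: "\<And>e. e > 0 \<Longrightarrow> \<exists>C. compact C \<and> (\<forall>x\<in>S. \<exists>y\<in>C. dist x y < e)"
  shows "compact (closure S)"
  unfolding compact_eq_totally_bounded
proof (intro conjI allI impI)
  show "complete (closure S)"
    by (rule complete_closed_subset[OF closed_closure subset_UNIV assms(1)])
  fix e :: real assume "e > 0"
  then obtain C where C: "compact C" "\<And>x. x \<in> S \<Longrightarrow> \<exists>y\<in>C. dist x y < e / 3"
    using approx[of "e / 3"] by auto
  then obtain k where k: "finite k" "C \<subseteq> (\<Union>x\<in>k. ball x (e / 3))"
    using \<open>e > 0\<close> unfolding compact_eq_totally_bounded by (metis divide_pos_pos zero_less_numeral)
  have "closure S \<subseteq> (\<Union>x\<in>k. ball x e)"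
  proof
    fix z assume "z \<in> closure S"
    then obtain x where x: "x \<in> S" "dist x z < e / 3"
      using \<open>e > 0\<close> unfolding closure_approachable by (metis divide_pos_pos zero_less_numeral)
    obtain y where y: "y \<in> C" "dist x y < e / 3" using C(2)[OF x(1)] by blast
    obtain u where u: "u \<in> k" "dist u y < e / 3" using k(2) y(1) by auto
    have "dist u z \<le> dist u y + dist x y + dist x z"
      by (smt (verit) dist_commute dist_triangle)
    then have "z \<in> ball u e" using u x y by simp
    then show "z \<in> (\<Union>x\<in>k. ball x e)" using u(1) by blast
  qed
  then show "\<exists>k. finite k \<and> closure S \<subseteq> (\<Union>x\<in>k. ball x e)" using k(1) by blast
qed

lemma norm_cscale: "norm (cscale u x) = cmod u * norm x"
proof -
  have "(norm (cscale u x))\<^sup>2 = (cmod u * norm x)\<^sup>2"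
    unfolding norm_ell2_sq power_mult_distrib
    by (simp add: coord_simps norm_mult power_mult_distrib suminf_mult summable_coord)
  then show ?thesis by (simp add: power2_eq_iff_nonneg)
qed

lemma bounded_finite_section_subset_compact:
  "\<exists>C. compact C \<and> {y. (\<forall>n\<ge>M. coord y n = 0) \<and> (\<forall>n. cmod (coord y n) \<le> R)} \<subseteq> C"
proof (induction M)
  case 0
  have "y = 0" if "\<forall>n. coord y n = 0" for y :: ell2
    using that by (intro ell2_eqI) (simp add: coord_simps)
  then show ?case by (intro exI[of _ "{0}"]) auto
next
  case (Suc M)
  then obtain C where C: "compact C"
    "{y. (\<forall>n\<ge>M. coord y n = 0) \<and> (\<forall>n. cmod (coord y n) \<le> R)} \<subseteq> C" by blast
  let ?e = "\<lambda>z. cscale z (unit_vec M)"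
  let ?D = "{u + v |u v. u \<in> C \<and> v \<in> ?e ` cball 0 R}"
  have "bounded_linear ?e"
    by (rule bounded_linear_intro[where K = "norm (unit_vec M)"])
      (auto simp: ell2.scale_left_distrib scaleR_ell2_def norm_cscale scaleR_conv_of_real)
  then have "compact ?D"
    by (intro compact_sums C compact_continuous_image linear_continuous_on compact_cball)
  moreover have "y \<in> ?D" if y: "\<And>n. n \<ge> Suc M \<Longrightarrow> coord y n = 0" "\<And>n. cmod (coord y n) \<le> R" for y
  proof -
    have R: "0 \<le> R" using y(2)[of 0] by simp
    let ?u = "y - ?e (coord y M)"
    have u: "coord ?u n = (if n = M then 0 else coord y n)" for n
      by (cases "n = 0") (auto simp: coord_simps)
    have "coord ?u n = 0" if "n \<ge> M" for n
      using y(1)[of n] that unfolding u by auto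
    moreover have "cmod (coord ?u n) \<le> R" for n
      unfolding u using y(2)[of n] R by auto
    ultimately have "?u \<in> C" using C(2) by blast
    moreover have "?e (coord y M) \<in> ?e ` cball 0 R" using y(2)[of M] by auto
    moreover have "y = ?u + ?e (coord y M)" by simp
    ultimately show ?thesis by blast
  qed
  ultimately show ?case by (intro exI[of _ ?D]) auto
qed

section \<open>Schatten norms of matrices with decaying weights\<close>

text \<open>
  On the corner \<open>n \<ge> M\<close>, \<open>m \<ge> M'\<close> the decaying factor is largest at its vertex and can be pulled out
  of the Schur bound. The case \<open>M = M'\<close> is used for singular values, \<open>M' = 1\<close> for compactness.
\<close>
lemma schur_bound_decaying_corner:
  assumes g: "schur_bound g w K" and "0 \<le> c" "0 \<le> \<kappa>"
    and le: "\<And>n m. n \<ge> 1 \<Longrightarrow> m \<ge> 1 \<Longrightarrow>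
      cmod (a n m) \<le> c * (real n * real m) powr (- \<kappa>) * cmod (g n m)"
    and "M \<ge> 1" "M' \<ge> 1"
  shows "schur_bound (\<lambda>n m. if n \<ge> M \<and> m \<ge> M' then a n m else 0) w
    (c * (real M * real M') powr (- \<kappa>) * K)"
proof (rule schur_bound_dominated[OF g])
  show "0 \<le> c * (real M * real M') powr (- \<kappa>)" using assms by simp
  fix n m :: nat assume nm: "n \<ge> 1" "m \<ge> 1"
  show "cmod (if n \<ge> M \<and> m \<ge> M' then a n m else 0)
      \<le> c * (real M * real M') powr (- \<kappa>) * cmod (g n m)"
  proof (cases "n \<ge> M \<and> m \<ge> M'")
    case True
    have "(real n * real m) powr (- \<kappa>) \<le> (real M * real M') powr (- \<kappa>)"
      using True assms by (intro powr_mono2' mult_mono) auto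
    then have "c * (real n * real m) powr (- \<kappa>) * cmod (g n m)
        \<le> c * (real M * real M') powr (- \<kappa>) * cmod (g n m)"
      using assms by (intro mult_right_mono mult_left_mono) auto
    then show ?thesis using True le[OF nm] by simp
  next
    case False
    then have "(if n \<ge> M \<and> m \<ge> M' then a n m else 0) = 0" by auto
    then show ?thesis using \<open>0 \<le> c\<close> by simp
  qed
qed

lemma schur_bound_decaying:
  assumes g: "schur_bound g w K" and "0 \<le> c" "0 \<le> \<kappa>"
    and le: "\<And>n m. n \<ge> 1 \<Longrightarrow> m \<ge> 1 \<Longrightarrow>
      cmod (a n m) \<le> c * (real n * real m) powr (- \<kappa>) * cmod (g n m)"
  shows "schur_bound a w (c * K)"
  using schur_bound_decaying_corner[OF assms, of 1 1] by (simp add: schur_bound_def)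

text \<open>
  With \<open>M = k div 2\<close>, the \<open>2 M < k + 1\<close> linear conditions that the first \<open>M\<close> coordinates of \<open>x\<close> and
  of \<open>A x\<close> vanish reduce \<open>A\<close> to the corner beyond \<open>M\<close>. Cutting rows and columns alike is what
  produces the exponent \<open>2 \<kappa>\<close> in place of \<open>\<kappa>\<close>.
\<close>
lemma singular_value_decaying_kernel:
  assumes g: "schur_bound g w K" and "0 \<le> c" "0 \<le> \<kappa>"
    and le: "\<And>n m. n \<ge> 1 \<Longrightarrow> m \<ge> 1 \<Longrightarrow>
      cmod (a n m) \<le> c * (real n * real m) powr (- \<kappa>) * cmod (g n m)"
  shows "0 \<le> singular_value (matrix_op a) (Suc k)"
    and "singular_value (matrix_op a) (Suc k) \<le> c * K * (real (Suc k) / 2) powr (- 2 * \<kappa>)"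
proof -
  define M where "M = k div 2"
  define C where "C = c * (real (Suc M) * real (Suc M)) powr (- \<kappa>) * K"
  let ?A = "matrix_op a" and ?T = "\<lambda>n m. if n \<ge> Suc M \<and> m \<ge> Suc M then a n m else 0"
  have K: "0 \<le> K" using g by (simp add: schur_bound_def)
  have sa: "schur_bound a w (c * K)" by (rule schur_bound_decaying[OF assms])
  have sT: "schur_bound ?T w C"
    unfolding C_def by (rule schur_bound_decaying_corner[OF assms]) auto
  have opA: "bounded_op ?A" by (rule bounded_op_matrix_op[OF sa])
  define L where "L j x = (if j < M then coord x (Suc j) else coord (?A x) (Suc (j - M)))" for j x
  have "norm (?A x) \<le> C * norm x" if x: "\<And>j. j < 2 * M \<Longrightarrow> L j x = 0" for x
  proof -
    have x0: "coord x n = 0" if "n \<le> M" for n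
      using x[of "n - 1"] that by (cases n) (auto simp: L_def)
    have Ax0: "coord (?A x) n = 0" if "n \<le> M" for n
      using x[of "M + (n - 1)"] that by (cases n) (auto simp: L_def)
    have "?A x = matrix_op ?T x"
    proof (rule ell2_eqI)
      fix n
      show "coord (?A x) n = coord (matrix_op ?T x) n"
      proof (cases "n \<le> M")
        case True
        then show ?thesis using Ax0[OF True] by (simp add: coord_matrix_op[OF sT])
      next
        case False
        have "(\<Sum>m. a n m * coord x m) = (\<Sum>m. ?T n m * coord x m)"
          using False x0 by (intro suminf_cong) auto
        then show ?thesis by (simp add: coord_matrix_op[OF sT] coord_matrix_op[OF sa])
      qed
    qed
    then show ?thesis using norm_matrix_op_le[OF sT] by simp
  qed
  moreover have "L j (x + y) = L j x + L j y" "L j (cscale u x) = u * L j x" for j u x y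
    using opA by (auto simp: L_def bounded_op_def coord_simps linear_simps)
  moreover have "0 \<le> C" using K \<open>0 \<le> c\<close> by (simp add: C_def)
  moreover have "2 * M < Suc k" by (simp add: M_def)
  ultimately have *: "0 \<le> singular_value ?A (Suc k)" "singular_value ?A (Suc k) \<le> C"
    using singular_value_bounds[OF opA bounded_op_matrix_op[OF schur_bound_adjoint[OF sa]]
        inner_matrix_op_adjoint[OF sa], of L "2 * M" C "Suc k"] by blast+
  show "0 \<le> singular_value ?A (Suc k)" by fact
  have "C = c * K * real (Suc M) powr (- 2 * \<kappa>)"
    by (simp add: C_def powr_mult flip: powr_add)
  also have "\<dots> \<le> c * K * (real (Suc k) / 2) powr (- 2 * \<kappa>)"
  proof (intro mult_left_mono powr_mono2')
    have "Suc k \<le> 2 * Suc M" unfolding M_def by presburger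
    then have "real (Suc k) \<le> real (2 * Suc M)" by (simp only: of_nat_le_iff)
    then show "real (Suc k) / 2 \<le> real (Suc M)" by simp
  qed (use K assms in auto)
  finally show "singular_value ?A (Suc k) \<le> c * K * (real (Suc k) / 2) powr (- 2 * \<kappa>)"
    using * by linarith
qed

text \<open>
  Deleting the rows from \<open>M\<close> on changes the operator by \<open>O(M\<^bsup>-\<kappa>\<^esup>)\<close> in norm, and leaves images of the
  unit ball in a bounded set of finitely supported sequences.
\<close>
lemma compact_op_decaying_kernel:
  assumes g: "schur_bound g w K" and "0 \<le> c" "0 < \<kappa>"
    and le: "\<And>n m. n \<ge> 1 \<Longrightarrow> m \<ge> 1 \<Longrightarrow>
      cmod (a n m) \<le> c * (real n * real m) powr (- \<kappa>) * cmod (g n m)"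
  shows "compact_op (matrix_op a)"
proof -
  have sa: "schur_bound a w (c * K)"
    by (rule schur_bound_decaying[OF g _ _ le]) (use assms in auto)
  have "compact (closure (matrix_op a ` cball 0 1))"
  proof (rule compact_closure_of_compact_approximations[OF complete_UNIV_ell2])
    fix e :: real assume "e > 0"
    have "(\<lambda>M. c * real M powr (- \<kappa>) * K) \<longlonglongrightarrow> c * 0 * K"
      using \<open>0 < \<kappa>\<close> by (intro tendsto_mult tendsto_const tendsto_neg_powr filterlim_real_sequentially) auto
    then have "eventually (\<lambda>M. c * real M powr (- \<kappa>) * K < e) sequentially"
      using \<open>e > 0\<close> by (intro order_tendstoD) auto
    then have "eventually (\<lambda>M. M \<ge> 1 \<and> c * real M powr (- \<kappa>) * K < e) sequentially"
      using eventually_ge_at_top[of 1] by eventually_elim auto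
    then obtain M where M: "M \<ge> 1" "c * real M powr (- \<kappa>) * K < e"
      by (auto simp: eventually_sequentially)
    let ?U = "\<lambda>n m. if n \<ge> M \<and> m \<ge> 1 then a n m else 0"
    have sU: "schur_bound ?U w (c * real M powr (- \<kappa>) * K)"
      using schur_bound_decaying_corner[OF g _ _ le, of M 1] M(1) assms(2,3) by simp
    obtain C where C: "compact C"
        "{y. (\<forall>n\<ge>M. coord y n = 0) \<and> (\<forall>n. cmod (coord y n) \<le> c * K)} \<subseteq> C"
      using bounded_finite_section_subset_compact by blast
    have "\<exists>y\<in>C. dist (matrix_op a x) y < e" if x: "norm x \<le> 1" for x
    proof
      let ?y = "matrix_op a x - matrix_op ?U x"
      have y: "coord ?y n = (if n \<ge> M then 0 else coord (matrix_op a x) n)" for n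
      proof (cases "n \<ge> M")
        case True
        have "(\<Sum>m. a n m * coord x m) = (\<Sum>m. ?U n m * coord x m)"
        proof (rule suminf_cong)
          fix m show "a n m * coord x m = ?U n m * coord x m" using True by (cases m) auto
        qed
        then show ?thesis using True by (simp add: coord_simps coord_matrix_op[OF sa] coord_matrix_op[OF sU]
            del: One_nat_def)
      qed (simp add: coord_simps coord_matrix_op[OF sU] del: One_nat_def)
      have "cmod (coord ?y n) \<le> c * K" for n
      proof -
        have "cmod (coord ?y n) \<le> cmod (coord (matrix_op a x) n)" unfolding y by simp
        also have "\<dots> \<le> c * K * norm x"
          using cmod_coord_le_norm norm_matrix_op_le[OF sa] order_trans by blast
        also have "\<dots> \<le> c * K"
          using x sa by (auto simp: schur_bound_def intro: mult_left_le)
        finally show ?thesis .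
      qed
      moreover have "coord ?y n = 0" if "n \<ge> M" for n
        unfolding y using that by simp
      ultimately show "?y \<in> C" by (intro subsetD[OF C(2)] CollectI conjI allI impI)
      have "dist (matrix_op a x) ?y = norm (matrix_op ?U x)" by (simp add: dist_norm)
      also have "\<dots> \<le> c * real M powr (- \<kappa>) * K * norm x" by (rule norm_matrix_op_le[OF sU])
      also have "\<dots> \<le> c * real M powr (- \<kappa>) * K"
        using x sU by (auto simp: schur_bound_def intro: mult_left_le)
      finally show "dist (matrix_op a x) ?y < e" using M(2) by linarith
    qed
    then show "\<exists>C. compact C \<and> (\<forall>z\<in>matrix_op a ` cball 0 1. \<exists>y\<in>C. dist z y < e)"
      using C(1) by (intro exI[of _ C]) auto
  qed
  then show ?thesis using bounded_op_matrix_op[OF sa] by (simp add: compact_op_def)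
qed

text \<open>
  The constant \<open>Z\<close> depends on \<open>g\<close>, \<open>\<kappa>\<close> and \<open>q\<close> but not on \<open>a\<close>; the bound is linear in \<open>c\<close>, so
  smallness of the entries passes to the Schatten norm.
\<close>
lemma schatten_decaying_kernel:
  assumes g: "schur_bound g w K" and "0 < \<kappa>" "1 < 2 * \<kappa> * q"
  shows "\<exists>Z. \<forall>a c. 0 \<le> c \<longrightarrow>
    (\<forall>n\<ge>1. \<forall>m\<ge>1. cmod (a n m) \<le> c * (real n * real m) powr (- \<kappa>) * cmod (g n m)) \<longrightarrow>
    matrix_op a \<in> schatten_class q \<and> schatten_norm q (matrix_op a) \<le> c * Z"
proof -
  have K: "0 \<le> K" using g by (simp add: schur_bound_def)
  have "q > 0" using assms by (smt (verit) mult_nonneg_nonpos)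
  define z where "z k = (real (Suc k) / 2) powr (- 2 * \<kappa> * q)" for k
  have "summable (\<lambda>k. real (Suc k) powr (- 2 * \<kappa> * q))"
    using assms(3) by (subst summable_Suc_iff) (simp add: summable_real_powr_iff)
  then have "summable (\<lambda>k. real (Suc k) powr (- 2 * \<kappa> * q) * (1 / 2) powr (- 2 * \<kappa> * q))"
    by (rule summable_mult2)
  then have z: "summable z"
    unfolding z_def by (simp add: powr_divide)
  have "matrix_op a \<in> schatten_class q \<and>
      schatten_norm q (matrix_op a) \<le> c * (K * suminf z powr (1 / q))"
    if c: "0 \<le> c" and le: "\<And>n m. n \<ge> 1 \<Longrightarrow> m \<ge> 1 \<Longrightarrow>
      cmod (a n m) \<le> c * (real n * real m) powr (- \<kappa>) * cmod (g n m)" for a c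
  proof
    let ?s = "\<lambda>k. singular_value (matrix_op a) (Suc k)"
    have s: "0 \<le> ?s k" "?s k \<le> c * K * (real (Suc k) / 2) powr (- 2 * \<kappa>)" for k
      using singular_value_decaying_kernel[OF g c _ le] \<open>0 < \<kappa>\<close> by auto
    have sq: "?s k powr q \<le> (c * K) powr q * z k" for k
    proof -
      have "?s k powr q \<le> (c * K * (real (Suc k) / 2) powr (- 2 * \<kappa>)) powr q"
        using s \<open>q > 0\<close> by (intro powr_mono2) auto
      also have "\<dots> = (c * K) powr q * z k"
        using c K by (simp add: powr_mult powr_powr z_def)
      finally show ?thesis .
    qed
    have sm: "summable (\<lambda>k. ?s k powr q)"
      by (rule summable_comparison_test'[OF summable_mult[OF z, of "(c * K) powr q"], of 0]) (simp add: sq)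
    then show "matrix_op a \<in> schatten_class q"
      using compact_op_decaying_kernel[OF g c \<open>0 < \<kappa>\<close> le] by (simp add: schatten_class_def)
    have "(\<Sum>k. ?s k powr q) \<le> (\<Sum>k. (c * K) powr q * z k)"
      by (intro suminf_le sq sm summable_mult z)
    also have "\<dots> = (c * K) powr q * suminf z" by (rule suminf_mult[OF z])
    finally have "schatten_norm q (matrix_op a) \<le> ((c * K) powr q * suminf z) powr (1 / q)"
      unfolding schatten_norm_def using \<open>q > 0\<close> by (intro powr_mono2 suminf_nonneg sm) auto
    also have "\<dots> = c * (K * suminf z powr (1 / q))"
      using c K \<open>q > 0\<close> suminf_nonneg[OF z] by (simp add: powr_mult powr_powr z_def)
    finally show "schatten_norm q (matrix_op a) \<le> c * (K * suminf z powr (1 / q))" .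
  qed
  then show ?thesis by blast
qed

section \<open>Power sums and the Gram matrix of the Toeplitz matrix\<close>

lemma powr_increment_mvt:
  fixes x \<rho> :: real
  assumes "x > 0"
  obtains \<xi> where "x < \<xi>" "\<xi> < x + 1" "(x + 1) powr \<rho> - x powr \<rho> = \<rho> * \<xi> powr (\<rho> - 1)"
proof -
  have "\<exists>z>x. z < x + 1 \<and> (x + 1) powr \<rho> - x powr \<rho> = (x + 1 - x) * (\<rho> * z powr (\<rho> - 1))"
  proof (rule MVT2)
    fix y assume "x \<le> y"
    then have "y > 0" using assms by linarith
    then show "((\<lambda>y. y powr \<rho>) has_real_derivative \<rho> * y powr (\<rho> - 1)) (at y)"
      by (rule has_real_derivative_powr)
  qed simp
  then show thesis using that by auto
qed

text \<open>
  Telescoping comparison of \<open>\<rho> j\<^bsup>\<rho>-1\<^esup>\<close> with the neighbouring increments of \<open>x\<^sup>\<rho>\<close>. The increment from \<open>0\<close>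
  to \<open>1\<close> is treated directly, because the derivative of \<open>x\<^sup>\<rho>\<close> may be unbounded near \<open>0\<close>.
\<close>
lemma powr_sum_bounds_le_1:
  fixes \<rho> :: real
  assumes "0 < \<rho>" "\<rho> \<le> 1"
  shows "(\<rho> * (\<Sum>j=1..K. real j powr (\<rho> - 1))) \<le> real K powr \<rho>"
    and "real (Suc K) powr \<rho> - 1 \<le> (\<rho> * (\<Sum>j=1..K. real j powr (\<rho> - 1)))"
proof -
  let ?S = "\<lambda>K. \<rho> * (\<Sum>j=1..K. real j powr (\<rho> - 1))"
  have step: "\<rho> * (x + 1) powr (\<rho> - 1) \<le> (x + 1) powr \<rho> - x powr \<rho>"
    "(x + 1) powr \<rho> - x powr \<rho> \<le> \<rho> * x powr (\<rho> - 1)" if x: "x > 0" for x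
  proof -
    obtain \<xi> where \<xi>: "x < \<xi>" "\<xi> < x + 1" "(x + 1) powr \<rho> - x powr \<rho> = \<rho> * \<xi> powr (\<rho> - 1)"
      using powr_increment_mvt[OF x] by blast
    have "(x + 1) powr (\<rho> - 1) \<le> \<xi> powr (\<rho> - 1)" "\<xi> powr (\<rho> - 1) \<le> x powr (\<rho> - 1)"
      using assms x \<xi> by (auto intro!: powr_mono2')
    then show "\<rho> * (x + 1) powr (\<rho> - 1) \<le> (x + 1) powr \<rho> - x powr \<rho>"
      "(x + 1) powr \<rho> - x powr \<rho> \<le> \<rho> * x powr (\<rho> - 1)"
      unfolding \<xi>(3) using assms by (auto intro: mult_left_mono)
  qed
  show "?S K \<le> real K powr \<rho>"
  proof (induction K)
    case (Suc K)
    have "\<rho> * real (Suc K) powr (\<rho> - 1) \<le> real (Suc K) powr \<rho> - real K powr \<rho>"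
      using step(1)[of "real K"] assms by (cases "K = 0") (auto simp: add.commute)
    with Suc show ?case by (simp add: distrib_left)
  qed simp
  show "real (Suc K) powr \<rho> - 1 \<le> ?S K"
  proof (induction K)
    case (Suc K)
    have "real (Suc (Suc K)) powr \<rho> - real (Suc K) powr \<rho> \<le> \<rho> * real (Suc K) powr (\<rho> - 1)"
      using step(2)[of "real (Suc K)"] by (simp add: add.commute)
    with Suc show ?case by (simp add: distrib_left)
  qed simp
qed

lemma powr_sum_bounds_ge_1:
  fixes \<rho> :: real
  assumes "1 \<le> \<rho>"
  shows "real K powr \<rho> \<le> \<rho> * (\<Sum>j=1..K. real j powr (\<rho> - 1))"
    and "\<rho> * (\<Sum>j=1..K. real j powr (\<rho> - 1)) \<le> real (Suc K) powr \<rho> - 1"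
    and "real (Suc K) powr \<rho> - real K powr \<rho> \<le> \<rho> * real (Suc K) powr (\<rho> - 1)"
proof -
  let ?S = "\<lambda>K. \<rho> * (\<Sum>j=1..K. real j powr (\<rho> - 1))"
  have step: "(x + 1) powr \<rho> - x powr \<rho> \<le> \<rho> * (x + 1) powr (\<rho> - 1)"
    "\<rho> * x powr (\<rho> - 1) \<le> (x + 1) powr \<rho> - x powr \<rho>" if x: "x > 0" for x
  proof -
    obtain \<xi> where \<xi>: "x < \<xi>" "\<xi> < x + 1" "(x + 1) powr \<rho> - x powr \<rho> = \<rho> * \<xi> powr (\<rho> - 1)"
      using powr_increment_mvt[OF x] by blast
    have "\<xi> powr (\<rho> - 1) \<le> (x + 1) powr (\<rho> - 1)" "x powr (\<rho> - 1) \<le> \<xi> powr (\<rho> - 1)"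
      using assms x \<xi> by (auto intro!: powr_mono2)
    then show "(x + 1) powr \<rho> - x powr \<rho> \<le> \<rho> * (x + 1) powr (\<rho> - 1)"
      "\<rho> * x powr (\<rho> - 1) \<le> (x + 1) powr \<rho> - x powr \<rho>"
      unfolding \<xi>(3) using assms by (auto intro: mult_left_mono)
  qed
  have step1: "real (Suc K) powr \<rho> - real K powr \<rho> \<le> \<rho> * real (Suc K) powr (\<rho> - 1)" for K
    using step(1)[of "real K"] assms by (cases "K = 0") (auto simp: add.commute)
  then show "real (Suc K) powr \<rho> - real K powr \<rho> \<le> \<rho> * real (Suc K) powr (\<rho> - 1)" .
  show "real K powr \<rho> \<le> ?S K"
  proof (induction K)
    case (Suc K)
    with step1[of K] show ?case by (simp add: distrib_left)
  qed simp
  show "?S K \<le> real (Suc K) powr \<rho> - 1"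
  proof (induction K)
    case (Suc K)
    have "\<rho> * real (Suc K) powr (\<rho> - 1) \<le> real (Suc (Suc K)) powr \<rho> - real (Suc K) powr \<rho>"
      using step(2)[of "real (Suc K)"] by (simp add: add.commute)
    with Suc show ?case by (simp add: distrib_left)
  qed simp
qed

text \<open>
  The true error is \<open>O(1)\<close> for \<open>\<rho> \<le> 1\<close> and \<open>O(x\<^bsup>\<rho>-1\<^esup>)\<close> for \<open>\<rho> \<ge> 1\<close>, as \<open>x \<rightarrow> \<infinity>\<close>. Giving up part of this
  saving makes the bound valid down to \<open>x \<rightarrow> 0\<close> as well: for \<open>x < 1\<close> the sum is empty, and
  \<open>x\<^sup>\<rho> \<le> x\<^bsup>\<rho>-\<eta>\<^esup>\<close>.
\<close>
lemma powr_sum_asymptotics: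
  fixes \<rho> \<eta> x :: real
  assumes "0 < \<eta>" "\<eta> \<le> 1" "\<eta> \<le> \<rho>" and x: "0 < x" "real K \<le> x" "x < real (Suc K)"
  shows "\<bar>\<rho> * (\<Sum>j=1..K. real j powr (\<rho> - 1)) - x powr \<rho>\<bar> \<le> (1 + \<rho> * 2 powr \<rho>) * x powr (\<rho> - \<eta>)"
proof -
  define S where "S = \<rho> * (\<Sum>j=1..K. real j powr (\<rho> - 1))"
  have \<rho>: "\<rho> > 0" using assms by linarith
  have Kx: "real K powr \<rho> \<le> x powr \<rho>" "x powr \<rho> \<le> real (Suc K) powr \<rho>"
    using x \<rho> by (auto intro!: powr_mono2)
  have "\<bar>S - x powr \<rho>\<bar> \<le> 1 * x powr (\<rho> - \<eta>) \<or> \<bar>S - x powr \<rho>\<bar> \<le> \<rho> * 2 powr \<rho> * x powr (\<rho> - \<eta>)"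
  proof -
    consider "x < 1" | "x \<ge> 1" "\<rho> \<le> 1" | "x \<ge> 1" "\<rho> \<ge> 1" by linarith
    then show ?thesis
    proof cases
      case 1
      then have "K = 0" using x by auto
      moreover have "x powr \<rho> \<le> x powr (\<rho> - \<eta>)"
        using 1 x assms by (intro powr_mono') auto
      ultimately show ?thesis by (simp add: S_def)
    next
      case 2
      have "\<bar>S - x powr \<rho>\<bar> \<le> 1"
        using powr_sum_bounds_le_1[OF \<rho> 2(2), of K] Kx unfolding S_def by linarith
      moreover have "1 \<le> x powr (\<rho> - \<eta>)"
        using 2 assms by (intro ge_one_powr_ge_zero) auto
      ultimately show ?thesis by linarith
    next
      case 3
      have "\<bar>S - x powr \<rho>\<bar> \<le> \<rho> * real (Suc K) powr (\<rho> - 1)"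
        using powr_sum_bounds_ge_1[OF 3(2), of K] Kx unfolding S_def by linarith
      also have "\<dots> \<le> \<rho> * (2 * x) powr (\<rho> - 1)"
        using \<rho> 3 x by (intro mult_left_mono powr_mono2) auto
      also have "\<dots> = \<rho> * (2 powr (\<rho> - 1) * x powr (\<rho> - 1))"
        using x by (simp add: powr_mult)
      also have "\<dots> \<le> \<rho> * (2 powr \<rho> * x powr (\<rho> - \<eta>))"
        using \<rho> 3 assms by (intro mult_left_mono mult_mono powr_mono) auto
      finally show ?thesis by (simp add: mult.assoc)
    qed
  qed
  moreover have "0 \<le> \<rho> * 2 powr \<rho> * x powr (\<rho> - \<eta>)" "0 \<le> x powr (\<rho> - \<eta>)" using \<rho> by auto
  ultimately show ?thesis unfolding S_def distrib_right by linarith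
qed

text \<open>
  The entries of \<open>T\<^sup>* T\<close> for the truncated Toeplitz matrix \<open>T\<close>, see \<open>coord_gram_operator\<close>. The sum
  vanishes by itself when \<open>n > N\<close> or \<open>m > N\<close>.
\<close>
definition toeplitz_gram :: "real \<Rightarrow> nat \<Rightarrow> nat \<Rightarrow> nat \<Rightarrow> real"
  where "toeplitz_gram \<sigma> N n m = (\<Sum>k=1..N. if n dvd k \<and> m dvd k
    then (real k / real n) powr (- \<sigma>) * (real k / real m) powr (- \<sigma>) else 0)"

lemma toeplitz_gram_eq:
  assumes "n \<ge> 1" "m \<ge> 1"
  shows "toeplitz_gram \<sigma> N n m = (real n powr \<sigma> * real m powr \<sigma>) * real (lcm n m) powr (- 2 * \<sigma>)
    * (\<Sum>j=1..N div lcm n m. real j powr (- 2 * \<sigma>))"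
proof -
  define L where "L = lcm n m"
  have L: "L > 0" using assms by (auto simp: L_def intro: lcm_pos_nat)
  have "toeplitz_gram \<sigma> N n m
      = (\<Sum>k\<in>{k\<in>{1..N}. L dvd k}. (real k / real n) powr (- \<sigma>) * (real k / real m) powr (- \<sigma>))"
    unfolding toeplitz_gram_def sum.inter_filter[OF finite_atLeastAtMost] by (simp add: L_def)
  also have "\<dots> = (\<Sum>j=1..N div L. (real (j * L) / real n) powr (- \<sigma>) * (real (j * L) / real m) powr (- \<sigma>))"
  proof (rule sum.reindex_bij_witness[where i = "\<lambda>j. j * L" and j = "\<lambda>k. k div L"])
    fix k assume "k \<in> {k\<in>{1..N}. L dvd k}"
    then show "k div L * L = k" "k div L \<in> {1..N div L}"
      using L by (auto simp: div_le_mono div_greater_zero_iff dvd_imp_le Suc_le_eq)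
  next
    fix j assume "j \<in> {1..N div L}"
    then show "j * L div L = j" "j * L \<in> {k\<in>{1..N}. L dvd k}"
      using L by (auto simp: less_eq_div_iff_mult_less_eq Suc_le_eq)
  qed auto
  also have "\<dots> = (\<Sum>j=1..N div L. (real n powr \<sigma> * real m powr \<sigma>) * real L powr (- 2 * \<sigma>) * real j powr (- 2 * \<sigma>))"
  proof (rule sum.cong[OF refl])
    fix j
    have sq: "y powr (- 2 * \<sigma>) = y powr (- \<sigma>) * y powr (- \<sigma>)" for y :: real
      by (simp flip: powr_add)
    have dv: "(real (j * L) / real i) powr (- \<sigma>) = real j powr (- \<sigma>) * real L powr (- \<sigma>) * real i powr \<sigma>" for i
      by (simp add: powr_divide powr_mult powr_minus_divide)
    show "(real (j * L) / real n) powr (- \<sigma>) * (real (j * L) / real m) powr (- \<sigma>)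
        = (real n powr \<sigma> * real m powr \<sigma>) * real L powr (- 2 * \<sigma>) * real j powr (- 2 * \<sigma>)"
      unfolding dv sq by (simp add: mult_ac)
  qed
  finally show ?thesis by (simp add: L_def sum_distrib_left)
qed

lemma toeplitz_gram_eq_0:
  assumes "m > N"
  shows "toeplitz_gram \<sigma> N n m = 0"
  unfolding toeplitz_gram_def using assms by (intro sum.neutral) (auto dest: dvd_imp_le)

lemma lcm_kernel_shift:
  assumes "n \<ge> 1" "m \<ge> 1"
  shows "lcm_kernel (\<theta> + \<tau>) n m = (real n * real m) powr \<tau> * lcm_kernel \<theta> n m"
  using assms by (simp add: lcm_kernel_def powr_add powr_mult)

text \<open>
  The lossy step \<open>(lcm n m)\<^sup>\<eta> \<le> (n m)\<^sup>\<eta>\<close> trades the decay in \<open>N / lcm n m\<close> for decay in \<open>N\<close> alone, at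
  the price of raising the exponent \<open>\<sigma>\<close> of the lcm matrix to \<open>\<sigma> + \<eta>\<close>.
\<close>
lemma toeplitz_gram_asymptotics:
  assumes \<rho>: "\<rho> = 1 - 2 * \<sigma>" and \<eta>: "0 < \<eta>" "\<eta> \<le> 1" "\<eta> \<le> \<rho>"
    and n: "n \<ge> 1" and m: "m \<ge> 1" and N: "N \<ge> 1"
  shows "\<bar>\<rho> * real N powr (- \<rho>) * toeplitz_gram \<sigma> N n m - lcm_kernel \<sigma> n m\<bar>
    \<le> (1 + \<rho> * 2 powr \<rho>) * real N powr (- \<eta>) * lcm_kernel (\<sigma> + \<eta>) n m"
proof -
  define L where "L = lcm n m"
  define x where "x = real N / real L"
  define K where "K = N div L"
  define S where "S = \<rho> * (\<Sum>j=1..K. real j powr (\<rho> - 1))"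
  have L: "L > 0" "real L \<le> real n * real m"
    using n m dvd_imp_le[of "lcm n m" "n * m"]
    by (auto simp: L_def intro: lcm_pos_nat simp flip: of_nat_mult)
  have x: "x > 0" "real K \<le> x" "x < real (Suc K)"
  proof -
    have "K * L \<le> N" "N < Suc K * L"
      using L dividend_less_div_times[of L N] by (auto simp: K_def)
    then have "real K * real L \<le> real N" "real N < real (Suc K) * real L"
      by (simp_all only: of_nat_mult[symmetric] of_nat_le_iff of_nat_less_iff)
    then show "x > 0" "real K \<le> x" "x < real (Suc K)"
      using L N by (simp_all only: x_def pos_le_divide_eq pos_divide_less_eq of_nat_0_less_iff) simp
  qed
  have two: "- 2 * \<sigma> = \<rho> - 1" using \<rho> by simp
  have NL: "real N powr (- \<rho>) * real L powr (\<rho> - 1) = x powr (- \<rho>) / real L"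
    using L by (simp add: x_def powr_divide powr_minus_divide powr_diff)
  have "\<rho> * real N powr (- \<rho>) * toeplitz_gram \<sigma> N n m
      = real n powr \<sigma> * real m powr \<sigma> * (real N powr (- \<rho>) * real L powr (\<rho> - 1)) * S"
    unfolding toeplitz_gram_eq[OF n m] two S_def K_def L_def by (simp only: mult_ac)
  also have "\<dots> = lcm_kernel \<sigma> n m * (x powr (- \<rho>) * S)"
    unfolding NL by (simp add: lcm_kernel_def L_def)
  finally have gram: "\<rho> * real N powr (- \<rho>) * toeplitz_gram \<sigma> N n m = lcm_kernel \<sigma> n m * (x powr (- \<rho>) * S)" .
  have "x powr (- \<rho>) * x powr \<rho> = 1" using x by (simp flip: powr_add)
  then have "\<bar>\<rho> * real N powr (- \<rho>) * toeplitz_gram \<sigma> N n m - lcm_kernel \<sigma> n m\<bar>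
      = \<bar>lcm_kernel \<sigma> n m * x powr (- \<rho>) * (S - x powr \<rho>)\<bar>"
    unfolding gram by (simp add: algebra_simps)
  also have "\<dots> = lcm_kernel \<sigma> n m * x powr (- \<rho>) * \<bar>S - x powr \<rho>\<bar>"
    by (simp add: abs_mult lcm_kernel_nonneg)
  also have "\<dots> \<le> lcm_kernel \<sigma> n m * x powr (- \<rho>) * ((1 + \<rho> * 2 powr \<rho>) * x powr (\<rho> - \<eta>))"
    unfolding S_def by (intro mult_left_mono powr_sum_asymptotics \<eta> x) (simp add: lcm_kernel_nonneg)
  also have "\<dots> = (1 + \<rho> * 2 powr \<rho>) * lcm_kernel \<sigma> n m * (x powr (- \<rho>) * x powr (\<rho> - \<eta>))"
    by simp
  also have "x powr (- \<rho>) * x powr (\<rho> - \<eta>) = x powr (- \<eta>)"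
    by (simp flip: powr_add)
  also have "\<dots> = real N powr (- \<eta>) * real L powr \<eta>"
    by (simp add: x_def powr_divide powr_minus_divide)
  also have "(1 + \<rho> * 2 powr \<rho>) * lcm_kernel \<sigma> n m * (real N powr (- \<eta>) * real L powr \<eta>)
      \<le> (1 + \<rho> * 2 powr \<rho>) * lcm_kernel \<sigma> n m * (real N powr (- \<eta>) * (real n * real m) powr \<eta>)"
    using L \<eta> by (intro mult_left_mono powr_mono2 mult_nonneg_nonneg) (auto simp: lcm_kernel_nonneg)
  also have "\<dots> = (1 + \<rho> * 2 powr \<rho>) * real N powr (- \<eta>) * lcm_kernel (\<sigma> + \<eta>) n m"
    using lcm_kernel_shift[OF n m] by simp
  finally show ?thesis .
qed


section \<open>Convergence in the Schatten norm\<close>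

lemma schur_bound_lcm_kernel:
  assumes "\<delta> > 0"
  shows "\<exists>K. schur_bound (\<lambda>n m. complex_of_real (lcm_kernel (1/2 - \<delta>) n m)) (\<lambda>n. real n powr (-1/2)) K"
proof -
  obtain K where K: "K > 0" "\<And>n M. n \<ge> 1 \<Longrightarrow>
      (\<Sum>m=1..M. lcm_kernel (1/2 - \<delta>) n m * real m powr (-1/2)) \<le> K * real n powr (-1/2)"
    using lcm_kernel_row_sum[OF assms] by blast
  have "cmod (complex_of_real (lcm_kernel \<theta> n m)) = lcm_kernel \<theta> n m" for \<theta> n m
    by (simp add: lcm_kernel_nonneg)
  then show ?thesis
    using K by (intro exI[of _ K]) (auto simp: schur_bound_def lcm_kernel_commute[of _ _ "_ :: nat"])
qed

lemma schur_bound_lcm_matrix: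
  assumes "\<sigma> < 1/2"
  shows "\<exists>w K. schur_bound (lcm_matrix \<sigma>) w K"
proof -
  define \<delta> where "\<delta> = (1/2 - \<sigma>) / 2"
  have \<delta>: "\<delta> > 0" "\<sigma> = 1/2 - \<delta> + (- \<delta>)" using assms by (auto simp: \<delta>_def field_simps)
  obtain K where K: "schur_bound (\<lambda>n m. complex_of_real (lcm_kernel (1/2 - \<delta>) n m)) (\<lambda>n. real n powr (-1/2)) K"
    using schur_bound_lcm_kernel[OF \<delta>(1)] by blast
  have "schur_bound (lcm_matrix \<sigma>) (\<lambda>n. real n powr (-1/2)) (1 * K)"
  proof (rule schur_bound_decaying[OF K])
    fix n m :: nat assume nm: "n \<ge> 1" "m \<ge> 1"
    have "cmod (lcm_matrix \<sigma> n m) = lcm_kernel \<sigma> n m"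
      by (simp add: lcm_matrix_def lcm_kernel_def norm_divide norm_mult)
    also have "\<dots> = (real n * real m) powr (- \<delta>) * lcm_kernel (1/2 - \<delta>) n m"
      using lcm_kernel_shift[OF nm, of "1/2 - \<delta>" "- \<delta>"] \<delta>(2) by simp
    finally show "cmod (lcm_matrix \<sigma> n m)
        \<le> 1 * (real n * real m) powr (- \<delta>) * cmod (complex_of_real (lcm_kernel (1/2 - \<delta>) n m))"
      by (simp add: lcm_kernel_nonneg)
  qed (use \<delta> in auto)
  then show ?thesis by blast
qed

definition difference_kernel :: "real \<Rightarrow> real \<Rightarrow> nat \<Rightarrow> nat \<Rightarrow> nat \<Rightarrow> complex"
  where "difference_kernel \<sigma> c N n m =
    complex_of_real (c * toeplitz_gram \<sigma> N n m) - lcm_matrix \<sigma> n m"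

lemma coord_gram_operator:
  assumes n: "n \<ge> 1"
  shows "coord (adjoint (toeplitz_op \<sigma> N) (toeplitz_op \<sigma> N x)) n
    = (\<Sum>m=1..N. complex_of_real (toeplitz_gram \<sigma> N n m) * coord x m)"
proof -
  define t where "t = toeplitz_matrix \<sigma> N"
  have t0: "t k m = 0" if "k \<notin> {1..N} \<or> m \<notin> {1..N}" for k m
    using that by (auto simp: t_def toeplitz_matrix_def)
  obtain K where K: "schur_bound t (\<lambda>_. 1) K"
    using schur_bound_finite_support[of N t] t0 by (metis atLeastAtMost_iff not_le)
  have T: "coord (matrix_op t x) k = (\<Sum>m=1..N. t k m * coord x m)" if "k \<ge> 1" for k
    using that t0 by (auto simp: coord_matrix_op[OF K] intro!: suminf_finite)
  have "coord (adjoint (matrix_op t) (matrix_op t x)) n = (\<Sum>k. cnj (t k n) * coord (matrix_op t x) k)"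
    using n by (simp add: adjoint_matrix_op[OF K] coord_matrix_op[OF schur_bound_adjoint[OF K]])
  also have "\<dots> = (\<Sum>k=1..N. cnj (t k n) * coord (matrix_op t x) k)"
    using t0 by (intro suminf_finite) auto
  also have "\<dots> = (\<Sum>k=1..N. \<Sum>m=1..N. cnj (t k n) * (t k m * coord x m))"
    by (intro sum.cong refl) (simp add: T sum_distrib_left)
  also have "\<dots> = (\<Sum>m=1..N. (\<Sum>k=1..N. cnj (t k n) * t k m) * coord x m)"
    by (subst sum.swap) (simp add: sum_distrib_right mult.assoc)
  also have "\<dots> = (\<Sum>m=1..N. complex_of_real (toeplitz_gram \<sigma> N n m) * coord x m)"
  proof (rule sum.cong[OF refl])
    fix m assume m: "m \<in> {1..N}"
    have "(\<Sum>k=1..N. cnj (t k n) * t k m) = complex_of_real (toeplitz_gram \<sigma> N n m)"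
      unfolding toeplitz_gram_def of_real_sum
    proof (rule sum.cong[OF refl])
      fix k assume k: "k \<in> {1..N}"
      have "n \<le> N" if "n dvd k" using dvd_imp_le[OF that] k by auto
      then show "cnj (t k n) * t k m = complex_of_real (if n dvd k \<and> m dvd k
          then (real k / real n) powr (- \<sigma>) * (real k / real m) powr (- \<sigma>) else 0)"
        using k m n by (auto simp: t_def toeplitz_matrix_def)
    qed
    then show "(\<Sum>k=1..N. cnj (t k n) * t k m) * coord x m
        = complex_of_real (toeplitz_gram \<sigma> N n m) * coord x m" by simp
  qed
  finally show ?thesis by (simp add: t_def toeplitz_op_def)
qed

lemma difference_operator_eq:
  assumes E: "schur_bound (lcm_matrix \<sigma>) w K" and D: "schur_bound (difference_kernel \<sigma> c N) w' K'"
  shows "c *\<^sub>R adjoint (toeplitz_op \<sigma> N) (toeplitz_op \<sigma> N x) - lcm_op \<sigma> x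
    = matrix_op (difference_kernel \<sigma> c N) x"
proof (rule ell2_eqI)
  fix n
  show "coord (c *\<^sub>R adjoint (toeplitz_op \<sigma> N) (toeplitz_op \<sigma> N x) - lcm_op \<sigma> x) n
    = coord (matrix_op (difference_kernel \<sigma> c N) x) n"
  proof (cases "n = 0")
    case False
    let ?f = "\<lambda>m. complex_of_real (c * toeplitz_gram \<sigma> N n m) * coord x m"
    have f0: "?f m = 0" if "m \<notin> {1..N}" for m
      using that toeplitz_gram_eq_0[of N m] by (cases "m = 0") auto
    have "coord (matrix_op (difference_kernel \<sigma> c N) x) n = (\<Sum>m. ?f m - lcm_matrix \<sigma> n m * coord x m)"
      using False by (simp add: coord_matrix_op[OF D] difference_kernel_def left_diff_distrib)
    also have "\<dots> = (\<Sum>m. ?f m) - (\<Sum>m. lcm_matrix \<sigma> n m * coord x m)"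
      using False f0
      by (intro suminf_diff[symmetric] schur_bound_summable[OF E] summable_finite[of "{1..N}"]) auto
    also have "(\<Sum>m. ?f m) = (\<Sum>m=1..N. ?f m)"
      using f0 by (intro suminf_finite) auto
    also have "\<dots> = c * coord (adjoint (toeplitz_op \<sigma> N) (toeplitz_op \<sigma> N x)) n"
      using False by (simp add: coord_gram_operator sum_distrib_left mult.assoc)
    finally show ?thesis
      using False by (simp add: coord_simps lcm_op_def coord_matrix_op[OF E])
  qed simp
qed

theorem theorem2p1:
  fixes \<sigma> \<rho> :: real and q :: nat
  assumes "\<sigma> < 1/2" and "\<rho> = 1 - 2 * \<sigma>"
    and "even q" and "real q * \<rho> > 1"
  shows "has_matrix (lcm_op \<sigma>) (lcm_matrix \<sigma>) \<and>
    (\<forall>N\<ge>1. (\<lambda>x. (\<rho> * real N powr (- \<rho>)) *\<^sub>R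
        adjoint (toeplitz_op \<sigma> N) (toeplitz_op \<sigma> N x) - lcm_op \<sigma> x) \<in> schatten_class (real q)) \<and>
    (\<lambda>N. schatten_norm (real q) (\<lambda>x. (\<rho> * real N powr (- \<rho>)) *\<^sub>R
        adjoint (toeplitz_op \<sigma> N) (toeplitz_op \<sigma> N x) - lcm_op \<sigma> x)) \<longlonglongrightarrow> 0"
    (is "_ \<and> (\<forall>N\<ge>1. ?D N \<in> _) \<and> _")
proof -
  have \<rho>: "\<rho> > 0" using assms by simp
  have q: "real q > 0" using assms(4) by (cases "q = 0") auto
  define r where "r = 1 / real q"
  have r: "0 < r" "r < \<rho>" "r * real q = 1"
    using assms(4) q by (auto simp: r_def field_simps)
  \<comment> \<open>Raising \<open>\<sigma>\<close> to \<open>\<sigma> + \<eta>\<close> and lowering \<open>1/2\<close> to \<open>1/2 - \<eta>\<close> leaves \<open>2 \<kappa> = \<rho> - 4 \<eta>\<close>, which has to exceed \<open>1/q\<close>.\<close>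
  define \<eta> where "\<eta> = min 1 ((\<rho> - r) / 5)"
  define \<kappa> where "\<kappa> = \<rho> / 2 - 2 * \<eta>"
  define C where "C = 1 + \<rho> * 2 powr \<rho>"
  have "0 < \<eta>" "\<eta> \<le> 1" "5 * \<eta> \<le> \<rho> - r"
    using r by (auto simp: \<eta>_def min_def)
  then have \<eta>: "0 < \<eta>" "\<eta> \<le> 1" "\<eta> \<le> \<rho>" "r < 2 * \<kappa>"
    using r(1) by (auto simp: \<kappa>_def)
  then have \<kappa>: "0 < \<kappa>" "1 < 2 * \<kappa> * real q"
    using r mult_strict_right_mono[OF \<eta>(4) q] by auto
  have C: "C > 0" using \<rho> by (simp add: C_def add_pos_pos)
  obtain w K where E: "schur_bound (lcm_matrix \<sigma>) w K"
    using schur_bound_lcm_matrix[OF assms(1)] by blast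
  let ?g = "\<lambda>n m. complex_of_real (lcm_kernel (1/2 - \<eta>) n m)"
  let ?a = "\<lambda>N. difference_kernel \<sigma> (\<rho> * real N powr (- \<rho>)) N"
  obtain B where B: "schur_bound ?g (\<lambda>n. real n powr (-1/2)) B"
    using schur_bound_lcm_kernel[OF \<eta>(1)] by blast
  have a: "cmod (?a N n m) \<le> C * real N powr (- \<eta>) * (real n * real m) powr (- \<kappa>) * cmod (?g n m)"
    if "N \<ge> 1" "n \<ge> 1" "m \<ge> 1" for N n m
  proof -
    have "\<sigma> + \<eta> = 1/2 - \<eta> + (- \<kappa>)" by (simp add: \<kappa>_def assms(2) field_simps)
    then have shift: "lcm_kernel (\<sigma> + \<eta>) n m = (real n * real m) powr (- \<kappa>) * lcm_kernel (1/2 - \<eta>) n m"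
      using lcm_kernel_shift[OF that(2,3)] by metis
    have "?a N n m = complex_of_real (\<rho> * real N powr (- \<rho>) * toeplitz_gram \<sigma> N n m - lcm_kernel \<sigma> n m)"
      by (simp add: difference_kernel_def lcm_matrix_def lcm_kernel_def)
    then have "cmod (?a N n m) = \<bar>\<rho> * real N powr (- \<rho>) * toeplitz_gram \<sigma> N n m - lcm_kernel \<sigma> n m\<bar>"
      by (simp only: norm_of_real)
    also have "\<dots> \<le> C * real N powr (- \<eta>) * lcm_kernel (\<sigma> + \<eta>) n m"
      unfolding C_def by (rule toeplitz_gram_asymptotics[OF assms(2) \<eta>(1-3) that(2,3,1)])
    finally show ?thesis by (simp add: shift lcm_kernel_nonneg mult.assoc)
  qed
  have c: "0 \<le> C * real N powr (- \<eta>)" for N using C by simp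
  have D: "?D N = matrix_op (?a N)" if "N \<ge> 1" for N
    using difference_operator_eq[OF E schur_bound_decaying[OF B c _ a[OF that]]] \<kappa> by auto
  obtain Z where Z: "\<And>a c. 0 \<le> c \<Longrightarrow>
      (\<forall>n\<ge>1. \<forall>m\<ge>1. cmod (a n m) \<le> c * (real n * real m) powr (- \<kappa>) * cmod (?g n m)) \<Longrightarrow>
      matrix_op a \<in> schatten_class (real q) \<and> schatten_norm (real q) (matrix_op a) \<le> c * Z"
    using schatten_decaying_kernel[OF B \<kappa>] by blast
  have main: "?D N \<in> schatten_class (real q)" "schatten_norm (real q) (?D N) \<le> C * real N powr (- \<eta>) * Z"
    if "N \<ge> 1" for N
    using Z[OF c, of "?a N" N] a[OF that] unfolding D[OF that] by auto
  have "(\<lambda>N. C * real N powr (- \<eta>) * Z) \<longlonglongrightarrow> C * 0 * Z"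
    using \<eta> by (intro tendsto_mult tendsto_const tendsto_neg_powr filterlim_real_sequentially) auto
  then have lim: "(\<lambda>N. C * real N powr (- \<eta>) * Z) \<longlonglongrightarrow> 0" by simp
  have "(\<lambda>N. schatten_norm (real q) (?D N)) \<longlonglongrightarrow> 0"
  proof (rule tendsto_sandwich[OF _ _ tendsto_const lim])
    show "eventually (\<lambda>N. 0 \<le> schatten_norm (real q) (?D N)) sequentially"
      by (simp add: schatten_norm_def)
    show "eventually (\<lambda>N. schatten_norm (real q) (?D N) \<le> C * real N powr (- \<eta>) * Z) sequentially"
      using eventually_ge_at_top[of 1] by eventually_elim (rule main(2))
  qed
  moreover have "has_matrix (lcm_op \<sigma>) (lcm_matrix \<sigma>)"
    unfolding lcm_op_def by (rule has_matrix_matrix_op[OF E])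
  ultimately show ?thesis using main(1) by blast
qed

end
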